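(* For any Pisot or Salem number $\beta$ the two values $$\sum_{m=1}^{\infty}\beta^{-\lfloor m^{\log m}\rfloor},\qquad \sum_{m=3}^{\infty}\beta^{-\lfloor m^{\log\log m}\rfloor}$$ are algebraically independent.
   Context: Algebraic independence is over $\mathbb{Q}$; $\lfloor x\rfloor$ is the integral part of $x$. A Pisot number is an algebraic integer greater than $1$ whose conjugates other than itself all have absolute value less than $1$. A Salem number is an algebraic integer greater than $1$ whose conjugates other than itself all have absolute value at most $1$, with at least one conjugate of absolute value exactly $1$. *)

theory Defs
  imports "HOL-Analysis.Analysis" "HOL-Computational_Algebra.Computational_Algebra"
begin

text \<open>
  Conjugates are taken in the complex numbers and are the roots of the minimal polynomial over
  the rationals, which is up to a unit the only irreducible rational polynomial with root \<open>x\<close>.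
  In particular, \<open>x\<close> is a conjugate of itself if it is algebraic.
\<close>

definition is_conjugate_of :: "complex \<Rightarrow> real \<Rightarrow> bool" where
  "is_conjugate_of z x \<longleftrightarrow>
     (\<exists>p :: rat poly. irreducible p \<and> poly (map_poly of_rat p) x = 0 \<and>
        poly (map_poly of_rat p) z = 0)"

definition pisot_number :: "real \<Rightarrow> bool" where
  "pisot_number \<beta> \<longleftrightarrow> algebraic_int \<beta> \<and> \<beta> > 1 \<and>
     (\<forall>z. is_conjugate_of z \<beta> \<and> z \<noteq> complex_of_real \<beta> \<longrightarrow> cmod z < 1)"

definition salem_number :: "real \<Rightarrow> bool" where
  "salem_number \<beta> \<longleftrightarrow> algebraic_int \<beta> \<and> \<beta> > 1 \<and>
     (\<forall>z. is_conjugate_of z \<beta> \<and> z \<noteq> complex_of_real \<beta> \<longrightarrow> cmod z \<le> 1) \<and>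
     (\<exists>z. is_conjugate_of z \<beta> \<and> cmod z = 1)"

text \<open>
  A polynomial in two variables $X$, $Y$ over the rationals is represented as a polynomial in $Y$
  whose coefficients are polynomials in $X$.
\<close>

definition eval_bivariate :: "rat poly poly \<Rightarrow> 'a :: field_char_0 \<Rightarrow> 'a \<Rightarrow> 'a" where
  "eval_bivariate P x y = poly (map_poly (\<lambda>q. poly (map_poly of_rat q) x) P) y"

definition algebraically_independent :: "'a :: field_char_0 \<Rightarrow> 'a \<Rightarrow> bool" where
  "algebraically_independent x y \<longleftrightarrow>
     (\<forall>P :: rat poly poly. P \<noteq> 0 \<longrightarrow> eval_bivariate P x y \<noteq> 0)"

end

theory Submission
  imports Defs
    "Jordan_Normal_Form.Char_Poly"
    "HOL-Computational_Algebra.Field_as_Ring"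
    "HOL-Real_Asymp.Real_Asymp"
begin

text \<open>
  Write the two values as $F_1(1/\beta)$ and $F_2(1/\beta)$ for power series with nonnegative integer
  coefficients supported on sparse sets $S_1$ and $S_2$, and suppose that $P(F_1, F_2)$ vanishes at
  $1/\beta$. Let $c X^k Y^D$ be the lexicographically leading monomial of $P$, where the degree in
  $Y$ is compared first, since $S_2$ is much denser than $S_1$. Counting shows that some sum $u$ of
  $k$ elements of $S_1$ and $D$ elements of $S_2$ lies in a window which contains no exponent coming
  from another monomial and few exponents in all, so that there are long gaps on both sides of $u$.

  All conjugates of $\beta$ other than $\beta$ have absolute value at most $1$, so the norm of a
  partial sum ending before a gap of logarithmic length forces this partial sum to vanish. Hence
  the terms between the two gaps sum to $0$. But they all have the sign of $c$, and the term at
  $u$ is not $0$.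
\<close>


section \<open>A lower bound for conjugate products\<close>

text \<open>Sums of type \<open>(k, D)\<close> cannot be separated from one another: counting only
  shows that few of them share a window. This is why a whole cluster of terms is isolated and not a
  single term. Sums with fewer elements of \<open>S2\<close> are rare enough to be avoided, because
  the power of \<open>exp (zeta x)\<close> that they lack outweighs every power of
  \<open>exp x\<close>. The obstacle is the sums with \<open>D\<close> elements of \<open>S2\<close>
  and fewer than \<open>k\<close> of \<open>S1\<close>: they lack only powers of
  \<open>exp x\<close>, which is less than the error in the count for \<open>S2\<close>, so counting
  them directly excludes nothing. They are handled by size: their part from \<open>S1\<close>
  differs from that of \<open>u\<close> by more than \<open>H\<close>, a fixed fraction of a gap of
  \<open>S1\<close>, and the part from \<open>S2\<close> can make up for this only by an unusually
  large element, which has hardly any freedom. At exponents of size about \<open>exp (x ^ 2)\<close>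
  the required gap is of order \<open>x ^ 2\<close>, while the windows have length about
  \<open>exp (zeta x / 2)\<close>, so there is ample room.\<close>

lemma irreducible_dvd_of_common_root:
  fixes p g :: "rat poly" and z :: complex
  assumes "irreducible p" "poly (map_poly of_rat p) z = 0" "poly (map_poly of_rat g) z = 0"
  shows "p dvd g"
proof (rule ccontr)
  assume "\<not> p dvd g"
  hence "coprime p g"
    using assms(1) by (simp add: irreducible_imp_prime_elem prime_elem_imp_coprime)
  then obtain a b where ab: "a * p + b * g = 1"
    using bezout_coefficients_fst_snd[of p g] by (auto simp: coprime_iff_gcd_eq_1)
  interpret h: map_poly_idom_hom "of_rat :: rat \<Rightarrow> complex" ..
  have "poly (map_poly of_rat (a * p + b * g)) z = 0"
    by (simp add: h.hom_add h.hom_mult assms)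
  with ab show False by simp
qed

text \<open>A nonzero annihilator of least degree is irreducible: in any factorisation one factor
  vanishes at \<open>z\<close>, hence has full degree and leaves a unit.\<close>

lemma irreducible_rat_poly_of_root:
  fixes F :: "rat poly" and z :: complex
  assumes "F \<noteq> 0" "poly (map_poly of_rat F) z = 0"
  shows "\<exists>p. irreducible p \<and> poly (map_poly of_rat p) z = 0"
proof -
  interpret h: map_poly_inj_idom_hom "of_rat :: rat \<Rightarrow> complex" ..
  define P where "P = (\<lambda>p::rat poly. p \<noteq> 0 \<and> poly (map_poly of_rat p) z = 0)"
  define p where "p = arg_min degree P"
  have "P F" using assms by (simp add: P_def)
  then have p: "P p" and min: "\<And>q. P q \<Longrightarrow> degree p \<le> degree q"
    unfolding p_def by (auto intro: arg_min_natI arg_min_nat_le)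
  have "irreducible p"
  proof (rule irreducibleI)
    show "p \<noteq> 0" using p by (simp add: P_def)
    show "\<not> p dvd 1"
    proof
      assume "p dvd 1"
      hence "degree p = 0" by (simp add: is_unit_iff_degree P_def p[unfolded P_def])
      then obtain c where "p = [:c:]" by (rule degree_eq_zeroE)
      with p show False unfolding P_def
        by (metis map_poly_0 of_rat_eq_0_iff map_poly_pCons mult_zero_right poly_pCons poly_0 add_0_right pCons_0_0)
    qed
    fix a b assume ab: "p = a * b"
    hence nz: "a \<noteq> 0" "b \<noteq> 0" using p by (auto simp: P_def)
    have deg: "degree p = degree a + degree b" using nz ab by (simp add: degree_mult_eq)
    have "poly (map_poly of_rat a) z = 0 \<or> poly (map_poly of_rat b) z = 0"
      using p by (simp add: P_def ab h.hom_mult)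
    then show "a dvd 1 \<or> b dvd 1"
    proof
      assume "poly (map_poly of_rat a) z = 0"
      with min[of a] deg nz have "degree b = 0" by (simp add: P_def)
      thus ?thesis using nz(2) by (simp add: is_unit_iff_degree)
    next
      assume "poly (map_poly of_rat b) z = 0"
      with min[of b] deg nz have "degree a = 0" by (simp add: P_def)
      thus ?thesis using nz(1) by (simp add: is_unit_iff_degree)
    qed
  qed
  thus ?thesis using p by (auto simp: P_def)
qed

text \<open>A repeated root would also be a root of \<open>pderiv p\<close>, so \<open>p\<close>
  would divide a nonzero polynomial of smaller degree. Distinctness of the roots is what makes the
  Vandermonde matrix of the conjugates invertible.\<close>

lemma card_roots_irreducible:
  fixes p :: "rat poly"
  assumes "irreducible p"
  shows "card {z::complex. poly (map_poly of_rat p) z = 0} = degree p"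
proof -
  let ?p = "map_poly of_rat p :: complex poly"
  have deg: "degree p \<noteq> 0"
    using assms by (auto simp: irreducible_def is_unit_iff_degree)
  have [simp]: "degree ?p = degree p" by simp
  have nz: "?p \<noteq> 0" using deg by auto
  have "rsquarefree ?p"
    unfolding rsquarefree_roots
  proof (intro allI notI)
    fix z assume z: "poly ?p z = 0 \<and> poly (pderiv ?p) z = 0"
    have "pderiv ?p = map_poly of_rat (pderiv p)"
      by (rule of_rat_hom.map_poly_pderiv [symmetric])
    with z have "p dvd pderiv p"
      using irreducible_dvd_of_common_root[OF assms, of z "pderiv p"] by simp
    moreover have "pderiv p \<noteq> 0" using deg by (simp add: pderiv_eq_0_iff)
    ultimately show False
      using deg dvd_imp_degree_le[of p "pderiv p"] by (simp add: degree_pderiv)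
  qed
  hence decomp: "Polynomial.smult (lead_coeff ?p) (\<Prod>z | poly ?p z = 0. [:- z, 1:]) = ?p"
    by (rule complex_poly_decompose_rsquarefree)
  have "degree ?p = degree (\<Prod>z | poly ?p z = 0. [:- z, 1:])"
    by (subst decomp [symmetric]) (use nz in simp)
  also have "\<dots> = card {z. poly ?p z = 0}"
    by (subst degree_prod_eq_sum_degree) auto
  finally show ?thesis by simp
qed

lemma finite_common_denominator:
  fixes X :: "rat set"
  assumes "finite X"
  shows "\<exists>d::int. d > 0 \<and> (\<forall>x\<in>X. of_int d * x \<in> \<int>)"
  using assms
proof induction
  case empty
  show ?case by (intro exI[of _ 1]) simp
next
  case (insert x X)
  then obtain d :: int where d: "d > 0" "\<forall>x\<in>X. of_int d * x \<in> \<int>" by blast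
  obtain a b where ab: "quotient_of x = (a, b)" by (cases "quotient_of x")
  have b: "b > 0" using quotient_of_denom_pos[OF ab] .
  have x: "of_int b * x = of_int a" using quotient_of_div[OF ab] b by simp
  show ?case
  proof (intro exI[of _ "d * b"] conjI ballI)
    show "d * b > 0" using d b by simp
    fix y assume "y \<in> insert x X"
    then show "of_int (d * b) * y \<in> \<int>"
    proof
      assume "y = x"
      hence "of_int (d * b) * y = of_int (d * a)" by (simp only: of_int_mult mult.assoc x)
      thus ?thesis by (simp only: Ints_of_int)
    next
      assume "y \<in> X"
      hence "of_int b * (of_int d * y) \<in> \<int>" using d(2) by (simp only: Ints_mult Ints_of_int)
      moreover have "of_int b * (of_int d * y) = of_int (d * b) * y" by simp
      ultimately show ?thesis by simp
    qed
  qed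
qed

text \<open>Although \<open>p\<close> need not be monic or integral, division by its monic multiple
  \<open>f\<close> first reduces every \<open>g\<close> to an integral combination of finitely many
  monomials, and only the residues of these need a denominator.\<close>

lemma int_poly_mod_common_denominator:
  fixes f :: "int poly" and p :: "rat poly"
  assumes "lead_coeff f = 1" and dvd: "p dvd map_poly of_int f"
  shows "\<exists>d::int. d > 0 \<and> (\<forall>(g::int poly) j. of_int d * coeff (map_poly of_int g mod p) j \<in> \<int>)"
proof -
  define X where "X = (\<lambda>(i,j). coeff (monom 1 i mod p) j) ` ({..degree f} \<times> {..degree p})"
  have "finite X" unfolding X_def by simp
  then obtain d :: int where d: "d > 0" "\<forall>x\<in>X. of_int d * x \<in> \<int>"
    using finite_common_denominator by blast
  have mon: "of_int d * coeff (monom 1 i mod p) j \<in> \<int>" if "i \<le> degree f" for i j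
  proof (cases "j \<le> degree p")
    case True
    thus ?thesis using d that unfolding X_def by force
  next
    case False
    moreover have "p \<noteq> 0" using dvd assms(1) by auto
    hence "degree (monom 1 i mod p) < degree p \<or> monom 1 i mod p = 0"
      using degree_mod_less by blast
    ultimately have "coeff (monom 1 i mod p) j = 0" by (auto intro: coeff_eq_0)
    thus ?thesis by simp
  qed
  have "of_int d * coeff (map_poly of_int g mod p) j \<in> \<int>" for g :: "int poly" and j
  proof -
    \<comment> \<open>For monic \<open>f\<close> pseudo-division is division over the integers: the
      factor in front of \<open>g\<close> is a power of 1.\<close>
    obtain a r where ar: "pseudo_divmod g f = (a, r)" by (cases "pseudo_divmod g f")
    have f0: "f \<noteq> 0" using assms(1) by auto
    have eq: "g = f * a + r" and r: "r = 0 \<or> degree r < degree f"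
      using pseudo_divmod[OF f0 ar] assms(1) by auto
    have dr: "degree r \<le> degree f" using r by auto
    have "map_poly of_int g mod p = (map_poly of_int f * map_poly of_int a + map_poly of_int r) mod p"
      by (simp add: eq of_int_poly_hom.hom_add of_int_poly_hom.hom_mult)
    also have "\<dots> = map_poly of_int r mod p"
      using dvd by (metis add_0 dvd_imp_mod_0 dvd_mult2 mod_add_left_eq)
    also have "\<dots> = (\<Sum>i\<le>degree f. Polynomial.smult (of_int (coeff r i)) (monom 1 i)) mod p"
      using poly_as_sum_of_monoms'[of "map_poly of_int r :: rat poly" "degree f"] dr
      by (simp add: smult_monom coeff_map_poly)
    also have "\<dots> = (\<Sum>i\<le>degree f. Polynomial.smult (of_int (coeff r i)) (monom 1 i mod p))"
    proof -
      have "(\<Sum>i\<in>A. h i) mod p = (\<Sum>i\<in>A. h i mod p)" if "finite A" for A and h :: "nat \<Rightarrow> rat poly"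
        using that by induction (auto simp: poly_mod_add_left)
      thus ?thesis by (simp add: mod_smult_left)
    qed
    finally have "of_int d * coeff (map_poly of_int g mod p) j =
        (\<Sum>i\<le>degree f. of_int (coeff r i) * (of_int d * coeff (monom 1 i mod p) j))"
      by (simp add: coeff_sum sum_distrib_left mult_ac)
    also have "\<dots> \<in> \<int>" by (intro Ints_sum Ints_mult mon) auto
    finally show ?thesis .
  qed
  with d show ?thesis by blast
qed

section \<open>The norm as a determinant\<close>

lemma det_in_Ints:
  assumes A: "A \<in> carrier_mat n n" and int: "\<And>i j. i < n \<Longrightarrow> j < n \<Longrightarrow> A $$ (i,j) \<in> \<int>"
  shows "Determinant.det A \<in> \<int>"
proof -
  have "signof \<pi> \<in> (\<int> :: 'a set)" for \<pi> :: "nat \<Rightarrow> nat"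
    by (simp add: sign_def)
  thus ?thesis
    unfolding det_def'[OF A]
    by (intro Ints_sum Ints_mult Ints_prod int) (auto simp: permutes_in_image)
qed

text \<open>A kernel vector of the transpose lists the coefficients of a polynomial of degree below
  \<open>n\<close> with the \<open>n\<close> roots \<open>\<alpha> l\<close>.\<close>

lemma vandermonde_det_nonzero:
  fixes \<alpha> :: "nat \<Rightarrow> complex"
  assumes "inj_on \<alpha> {0..<n}"
  shows "Determinant.det (Matrix.mat n n (\<lambda>(j,l). \<alpha> l ^ j)) \<noteq> 0"
proof
  let ?W = "Matrix.mat n n (\<lambda>(j,l). \<alpha> l ^ j)"
  assume "Determinant.det ?W = 0"
  hence "Determinant.det (transpose_mat ?W) = 0"
    by (subst det_transpose[of _ n]) auto
  moreover have "transpose_mat ?W \<in> carrier_mat n n" by simp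
  ultimately obtain v where v: "v \<in> carrier_vec n" "v \<noteq> 0\<^sub>v n" "transpose_mat ?W *\<^sub>v v = 0\<^sub>v n"
    using det_0_iff_vec_prod_zero_field by blast
  define g where "g = (\<Sum>j<n. monom (vec_index v j) j)"
  have coeff_g: "coeff g j = (if j < n then vec_index v j else 0)" for j
    by (simp add: g_def coeff_sum coeff_monom if_distrib cong: if_cong)
  have root: "poly g (\<alpha> l) = 0" if "l < n" for l
  proof -
    have "0 = vec_index (transpose_mat ?W *\<^sub>v v) l" by (simp only: v(3)) (use that in simp)
    also have "\<dots> = (\<Sum>j = 0..<n. \<alpha> l ^ j * vec_index v j)"
      using that v(1) by (simp add: scalar_prod_def)
    also have "\<dots> = poly g (\<alpha> l)"
      by (simp add: g_def poly_sum poly_monom mult_ac atLeast0LessThan)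
    finally show ?thesis by simp
  qed
  have "g \<noteq> 0"
  proof
    assume "g = 0"
    hence "vec_index v j = 0" if "j < n" for j using coeff_g[of j] that by simp
    hence "v = 0\<^sub>v n" using v by (intro eq_vecI) auto
    with v show False by simp
  qed
  have "n = card (\<alpha> ` {0..<n})" using assms by (simp add: card_image)
  also have "\<dots> \<le> card {x. poly g x = 0}"
    using root \<open>g \<noteq> 0\<close> by (intro card_mono poly_roots_finite) auto
  also have "\<dots> \<le> degree g" using \<open>g \<noteq> 0\<close> by (rule card_poly_roots_bound)
  finally have "n \<le> degree g" .
  hence "coeff g (degree g) = 0" by (simp add: coeff_g)
  with \<open>g \<noteq> 0\<close> show False by simp
qed

text \<open>The product is the absolute value of the norm of the algebraic integer
  \<open>q(\<beta>)\<close>, a nonzero rational integer. Any positive constant \<open>c\<close>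
  serves the later argument, so a bounded denominator is shown in place of integrality.\<close>

lemma conjugate_product_ge:
  fixes \<beta> :: real
  assumes "algebraic_int \<beta>"
  shows "\<exists>R. finite R \<and> complex_of_real \<beta> \<in> R \<and> (\<forall>z\<in>R. is_conjugate_of z \<beta>) \<and>
    (\<exists>c>0. \<forall>q :: int poly. poly (map_poly of_int q) (complex_of_real \<beta>) \<noteq> 0 \<longrightarrow>
      c \<le> (\<Prod>z\<in>R. cmod (poly (map_poly of_int q) z)))"
proof -
  obtain f :: "int poly" where f: "poly (map_poly of_int f) \<beta> = 0" "lead_coeff f = 1"
    using assms by (auto simp: algebraic_int_altdef_ipoly)
  let ?ev = "\<lambda>q::rat poly. poly (map_poly of_rat q) :: complex \<Rightarrow> complex"
  have of_int_rat: "(map_poly of_rat (map_poly of_int q :: rat poly) :: complex poly) = map_poly of_int q" for q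
    by (simp add: map_poly_map_poly o_def)
  have real_root: "complex_of_real (poly (map_poly of_rat q) x) = ?ev q (complex_of_real x)" for q :: "rat poly" and x
  proof -
    have "complex_of_real (real_of_rat y) = of_rat y" for y
      by (induct y) (simp add: of_rat_rat)
    hence "?ev q (complex_of_real x) = poly (map_poly complex_of_real (map_poly of_rat q)) (complex_of_real x)"
      by (simp add: map_poly_map_poly o_def)
    thus ?thesis by simp
  qed
  interpret h: map_poly_idom_hom "of_rat :: rat \<Rightarrow> complex" ..
  have ev_mult: "?ev (a * b) z = ?ev a z * ?ev b z" and ev_add: "?ev (a + b) z = ?ev a z + ?ev b z" for a b z
    by (simp_all add: h.hom_mult h.hom_add)
  have ev_monom: "?ev (monom 1 i) z = z ^ i" for i z
    by (simp add: map_poly_monom poly_monom)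
  define F where "F = (map_poly of_int f :: rat poly)"
  have "F \<noteq> 0" using f(2) by (auto simp: F_def)
  have "?ev F (complex_of_real \<beta>) = complex_of_real (poly (map_poly of_rat F) \<beta>)" by (simp add: real_root)
  also have "map_poly of_rat F = (map_poly of_int f :: real poly)"
    by (simp add: F_def map_poly_map_poly o_def)
  finally have F_root: "?ev F (complex_of_real \<beta>) = 0" using f(1) by simp
  obtain p where p: "irreducible p" "?ev p (complex_of_real \<beta>) = 0"
    using irreducible_rat_poly_of_root[OF \<open>F \<noteq> 0\<close> F_root] by blast
  have p_real: "poly (map_poly of_rat p) \<beta> = 0"
    using p(2) real_root[of p \<beta>] by simp
  have "p dvd F" by (rule irreducible_dvd_of_common_root[OF p F_root])
  obtain \<Delta> :: int where \<Delta>: "\<Delta> > 0" "\<And>g j. of_int \<Delta> * coeff (map_poly of_int g mod p) j \<in> \<int>"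
    using int_poly_mod_common_denominator[of f p] f(2) \<open>p dvd F\<close> unfolding F_def by blast
  define R where "R = {z. ?ev p z = 0}"
  define d where "d = degree p"
  have "p \<noteq> 0" using p(1) by auto
  have "finite R"
    unfolding R_def by (rule poly_roots_finite) (use \<open>p \<noteq> 0\<close> in simp)
  have cardR: "card R = d"
    unfolding R_def d_def by (rule card_roots_irreducible[OF p(1)])
  obtain \<alpha> where \<alpha>: "bij_betw \<alpha> {0..<d} R"
    using ex_bij_betw_nat_finite[OF \<open>finite R\<close>] cardR by auto
  have d0: "d > 0" using cardR \<open>finite R\<close> p(2) by (auto simp: R_def card_gt_0_iff)
  define c where "c = 1 / (of_int \<Delta> ^ d :: real)"
  have "c \<le> (\<Prod>z\<in>R. cmod (poly (map_poly of_int q) z))"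
    if q: "poly (map_poly of_int q) (complex_of_real \<beta>) \<noteq> 0" for q :: "int poly"
  proof -
    define Q where "Q = (map_poly of_int q :: rat poly)"
    have evQ: "?ev Q z = poly (map_poly of_int q) z" for z
      by (simp add: Q_def of_int_rat)
    \<comment> \<open>A zero at one conjugate would make \<open>p\<close> divide \<open>Q\<close>
      and force a zero at \<open>\<beta>\<close>.\<close>
    have Q_root: "?ev Q z \<noteq> 0" if "z \<in> R" for z
    proof
      assume "?ev Q z = 0"
      with that have "p dvd Q" using irreducible_dvd_of_common_root[OF p(1)] by (simp add: R_def)
      then obtain h where "Q = p * h" by blast
      hence "?ev Q (complex_of_real \<beta>) = 0" using p(2) by (simp add: ev_mult)
      with q evQ show False by simp
    qed
    define r where "r = (\<lambda>i. (Q * monom 1 i) mod p)"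
    have r_ev: "?ev (r i) z = ?ev Q z * z ^ i" if "z \<in> R" for i z
    proof -
      have "Q * monom 1 i = p * ((Q * monom 1 i) div p) + r i" by (simp add: r_def)
      hence "?ev (Q * monom 1 i) z = ?ev (p * ((Q * monom 1 i) div p) + r i) z" by simp
      also have "\<dots> = ?ev (r i) z" using that by (simp only: ev_mult ev_add) (simp add: R_def)
      finally show ?thesis by (simp only: ev_mult ev_monom)
    qed
    have r_deg: "coeff (r i) j = 0" if "j \<ge> d" for i j
    proof -
      have "r i = 0 \<or> degree (r i) < d" 
        unfolding r_def d_def using degree_mod_less[OF \<open>p \<noteq> 0\<close>] by blast
      thus ?thesis using that by (auto intro: coeff_eq_0)
    qed
    define M where "M = Matrix.mat d d (\<lambda>(i,j). coeff (r i) j)"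
    define W where "W = Matrix.mat d d (\<lambda>(j,l). \<alpha> l ^ j)"
    define D where "D = Matrix.mat d d (\<lambda>(i,j). if i = j then ?ev Q (\<alpha> i) else 0)"
    define N where "N = map_mat (of_rat :: rat \<Rightarrow> complex) M"
    have carr: "M \<in> carrier_mat d d" "W \<in> carrier_mat d d" "D \<in> carrier_mat d d" "N \<in> carrier_mat d d"
      by (auto simp: M_def W_def D_def N_def)
    \<comment> \<open>\<open>M\<close> is multiplication by \<open>q\<close> modulo \<open>p\<close>; the columns of the Vandermonde matrix \<open>W\<close> are its eigenvectors,
      so \<open>det M\<close> is the norm of \<open>q(\<beta>)\<close>.\<close>
    have "N * W = W * D"
    proof (rule eq_matI)
      fix i l assume "i < dim_row (W * D)" "l < dim_col (W * D)"
      hence il: "i < d" "l < d" using carr by auto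
      hence "\<alpha> l \<in> R" using \<alpha> by (auto simp: bij_betw_def)
      have "(N * W) $$ (i, l) = (\<Sum>j = 0..<d. of_rat (coeff (r i) j) * \<alpha> l ^ j)"
        using il by (simp add: N_def M_def W_def scalar_prod_def)
      also have "\<dots> = ?ev (r i) (\<alpha> l)"
      proof -
        have "degree (map_poly of_rat (r i) :: complex poly) \<le> d - 1"
          by (rule degree_le) (use r_deg in \<open>auto simp: coeff_map_poly\<close>)
        hence "?ev (r i) (\<alpha> l) = poly (\<Sum>j\<le>d - 1. monom (of_rat (coeff (r i) j)) j) (\<alpha> l)"
          using poly_as_sum_of_monoms'[of "map_poly of_rat (r i) :: complex poly" "d - 1"]
          by (simp add: coeff_map_poly)
        hence "?ev (r i) (\<alpha> l) = (\<Sum>j\<le>d - 1. of_rat (coeff (r i) j) * \<alpha> l ^ j)"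
          by (simp add: poly_sum poly_monom)
        moreover have "{..d - 1} = {0..<d}" using d0 by auto
        ultimately show ?thesis by simp
      qed
      also have "\<dots> = \<alpha> l ^ i * ?ev Q (\<alpha> l)" using r_ev[OF \<open>\<alpha> l \<in> R\<close>] by simp
      also have "\<dots> = (\<Sum>j = 0..<d. \<alpha> j ^ i * (if j = l then ?ev Q (\<alpha> j) else 0))"
        using il by (simp add: if_distrib cong: if_cong)
      also have "\<dots> = (W * D) $$ (i, l)"
        using il by (simp add: W_def D_def scalar_prod_def)
      finally show "(N * W) $$ (i, l) = (W * D) $$ (i, l)" .
    qed (use carr in auto)
    hence "Determinant.det N * Determinant.det W = Determinant.det W * Determinant.det D"
      using carr by (metis det_mult)
    moreover have "Determinant.det W \<noteq> 0"
      unfolding W_def by (rule vandermonde_det_nonzero) (use \<alpha> in \<open>auto simp: bij_betw_def\<close>)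
    ultimately have "Determinant.det N = Determinant.det D" by simp
    also have "\<dots> = (\<Prod>i = 0..<d. ?ev Q (\<alpha> i))"
      by (subst det_lower_triangular[of d])
         (auto simp: D_def diag_mat_def prod.list_conv_set_nth intro!: prod.cong)
    also have "\<dots> = (\<Prod>z\<in>R. ?ev Q z)"
      using \<alpha> by (intro prod.reindex_bij_betw)
    finally have detN: "Determinant.det N = (\<Prod>z\<in>R. ?ev Q z)" .
    have "Determinant.det (of_int \<Delta> \<cdot>\<^sub>m M) \<in> \<int>"
    proof (rule det_in_Ints[of _ d])
      fix i j assume ij: "i < d" "j < d"
      have "Q * monom 1 i = map_poly of_int (q * monom 1 i)"
        by (simp add: Q_def hom_distribs)
      thus "(of_int \<Delta> \<cdot>\<^sub>m M) $$ (i, j) \<in> \<int>"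
        using ij \<Delta>(2)[of "q * monom 1 i" j] by (simp add: M_def r_def)
    qed (use carr in auto)
    hence "of_int \<Delta> ^ d * Determinant.det M \<in> \<int>" using carr(1) by simp
    then obtain k :: int where k: "of_int \<Delta> ^ d * Determinant.det M = of_int k" by (elim Ints_cases)
    have "(of_int \<Delta> ^ d :: complex) * Determinant.det N = of_rat (of_int \<Delta> ^ d * Determinant.det M)"
      by (simp add: N_def of_rat_mult of_rat_power)
    hence eq: "(of_int \<Delta> ^ d :: complex) * (\<Prod>z\<in>R. ?ev Q z) = of_int k"
      by (simp add: k detN)
    moreover have "(\<Prod>z\<in>R. ?ev Q z) \<noteq> 0" using Q_root \<open>finite R\<close> by simp
    ultimately have "k \<noteq> 0" using \<Delta>(1) by auto
    hence "1 \<le> cmod (of_int k)" by simp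
    also have "\<dots> = of_int \<Delta> ^ d * (\<Prod>z\<in>R. cmod (?ev Q z))"
      using \<Delta>(1) by (simp add: norm_mult norm_power prod_norm flip: eq)
    finally show ?thesis using \<Delta>(1) by (simp add: c_def evQ field_simps)
  qed
  moreover have "c > 0" using \<Delta>(1) by (simp add: c_def)
  moreover have "\<forall>z\<in>R. is_conjugate_of z \<beta>"
    unfolding is_conjugate_of_def R_def using p(1) p_real by blast
  moreover have "complex_of_real \<beta> \<in> R" using p(2) by (simp add: R_def)
  ultimately show ?thesis using \<open>finite R\<close> by blast
qed


section \<open>Clusters of a vanishing series\<close>

text \<open>Since \<open>n + N + 1 \<le> (N + 1) * (n + 1)\<close>, the polynomial factor splits,
  and the remaining constant does not depend on \<open>N\<close>.\<close>

lemma poly_growth_tail_bound: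
  fixes \<rho> :: "nat \<Rightarrow> real" and b :: real
  assumes b: "0 < b" "b < 1" and C: "C \<ge> 0"
    and bound: "\<And>n. \<bar>\<rho> n\<bar> \<le> C * real (n + 1) ^ e"
  shows "summable (\<lambda>n. real (n + 1) ^ e * b ^ n)"
    and "\<bar>\<Sum>n. \<rho> (n + N) * b ^ (n + N)\<bar> \<le>
      b ^ N * real (N + 1) ^ e * (C * (\<Sum>n. real (n + 1) ^ e * b ^ n))"
proof -
  show sm: "summable (\<lambda>n. real (n + 1) ^ e * b ^ n)"
  proof (rule summable_comparison_test_bigo)
    define q where "q = (1 + b) / 2"
    have q: "b < q" "0 < q" "q < 1" using b by (auto simp: q_def)
    show "summable (\<lambda>n. norm (q ^ n))" using q by (simp add: summable_geometric)
    show "(\<lambda>n. real (n + 1) ^ e * b ^ n) \<in> O(\<lambda>n. q ^ n)"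
      using b q by real_asymp
  qed
  let ?g = "\<lambda>n. b ^ N * real (N + 1) ^ e * (C * (real (n + 1) ^ e * b ^ n))"
  have le: "norm (\<rho> (n + N) * b ^ (n + N)) \<le> ?g n" for n
  proof -
    have "real (n + N + 1) \<le> real (N + 1) * real (n + 1)"
      by (simp add: algebra_simps)
    hence "real (n + N + 1) ^ e \<le> real (N + 1) ^ e * real (n + 1) ^ e"
      unfolding power_mult_distrib [symmetric] by (intro power_mono) auto
    hence "C * real (n + N + 1) ^ e \<le> C * (real (N + 1) ^ e * real (n + 1) ^ e)"
      using C by (rule mult_left_mono)
    with bound[of "n + N"] have "\<bar>\<rho> (n + N)\<bar> \<le> C * (real (N + 1) ^ e * real (n + 1) ^ e)" by linarith
    hence "\<bar>\<rho> (n + N)\<bar> * b ^ (n + N) \<le> C * (real (N + 1) ^ e * real (n + 1) ^ e) * b ^ (n + N)"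
      using b by (intro mult_right_mono) auto
    thus ?thesis using b by (simp add: abs_mult power_add mult_ac)
  qed
  have sg: "summable ?g" by (intro summable_mult sm)
  have "\<bar>\<Sum>n. \<rho> (n + N) * b ^ (n + N)\<bar> \<le> (\<Sum>n. ?g n)"
    using norm_suminf_le[OF le sg] by simp
  also have "\<dots> = b ^ N * real (N + 1) ^ e * (C * (\<Sum>n. real (n + 1) ^ e * b ^ n))"
    by (simp only: suminf_mult sm summable_mult)
  finally show "\<bar>\<Sum>n. \<rho> (n + N) * b ^ (n + N)\<bar> \<le>
      b ^ N * real (N + 1) ^ e * (C * (\<Sum>n. real (n + 1) ^ e * b ^ n))" .
qed

text \<open>
  After a gap of length \<open>G\<close> the tail is of order $\beta^{-R-G}$, while the other conjugates of the
  algebraic integer \<open>\<beta>\<^sup>R\<close> times the partial sum grow only polynomially in \<open>R\<close>, so a logarithmic gap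
  contradicts the lower bound for the conjugate product unless the partial sum vanishes.
\<close>

lemma cluster_sum_eq_0:
  fixes \<beta> :: real and \<rho> :: "nat \<Rightarrow> int"
  assumes "algebraic_int \<beta>" "\<beta> > 1"
    and conj: "\<And>z. is_conjugate_of z \<beta> \<Longrightarrow> z \<noteq> complex_of_real \<beta> \<Longrightarrow> cmod z \<le> 1"
    and bound: "\<And>n. \<bar>real_of_int (\<rho> n)\<bar> \<le> C * real (n + 1) ^ e"
    and zero: "(\<lambda>n. of_int (\<rho> n) * (1 / \<beta>) ^ n) sums 0"
  shows "\<exists>B>0. \<forall>R G. (\<forall>n. R < n \<and> n \<le> R + G \<longrightarrow> \<rho> n = 0) \<longrightarrow> B * ln (real (R + G + 2)) \<le> real G \<longrightarrow>
    (\<Sum>n\<le>R. of_int (\<rho> n) * (1 / \<beta>) ^ n) = 0"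
proof -
  obtain Z c where Z: "finite Z" "complex_of_real \<beta> \<in> Z" "\<And>z. z \<in> Z \<Longrightarrow> is_conjugate_of z \<beta>" "c > 0"
    and c: "\<And>q :: int poly. poly (map_poly of_int q) (complex_of_real \<beta>) \<noteq> 0 \<Longrightarrow>
      c \<le> (\<Prod>z\<in>Z. cmod (poly (map_poly of_int q) z))"
    using conjugate_product_ge[OF assms(1)] by blast
  define b where "b = 1 / \<beta>"
  have b: "0 < b" "b < 1" "b * \<beta> = 1" using assms(2) by (auto simp: b_def)
  define D where "D = max C 1"
  have D: "D \<ge> 1" "\<And>n. \<bar>real_of_int (\<rho> n)\<bar> \<le> D * real (n + 1) ^ e"
  proof -
    show "D \<ge> 1" by (simp add: D_def)
    fix n
    have "C * real (n + 1) ^ e \<le> D * real (n + 1) ^ e" by (intro mult_right_mono) (auto simp: D_def)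
    with bound[of n] show "\<bar>real_of_int (\<rho> n)\<bar> \<le> D * real (n + 1) ^ e" by linarith
  qed
  define K where "K = D * (\<Sum>n. real (n + 1) ^ e * b ^ n)"
  define r where "r = card Z - 1"
  \<comment> \<open>\<open>X\<close> enters with exponent \<open>e\<close> from the tail and
    \<open>e + 1\<close> from each of the \<open>r\<close> other conjugates. Dividing
    \<open>ln K'\<close> by \<open>ln 2\<close> in \<open>B\<close> lets \<open>ln X\<close> absorb
    the constant, as \<open>X \<ge> 2\<close>; the final 1 makes \<open>B\<close> positive.\<close>
  define E where "E = e + (e + 1) * r"
  define K' where "K' = max 1 (K * D ^ r / c)"
  define B where "B = ((ln K' / ln 2 + E) + 1) / ln \<beta>"
  have "K' \<ge> 1" by (simp add: K'_def)
  have ln\<beta>: "ln \<beta> > 0" using assms(2) by simp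
  have "B > 0" using ln\<beta> \<open>K' \<ge> 1\<close> by (auto simp: B_def intro!: divide_pos_pos add_nonneg_pos)
  moreover have "(\<Sum>n\<le>R. of_int (\<rho> n) * (1 / \<beta>) ^ n) = 0"
    if gap: "\<forall>n. R < n \<and> n \<le> R + G \<longrightarrow> \<rho> n = 0" and G: "B * ln (real (R + G + 2)) \<le> real G" for R G
  proof (rule ccontr)
    define S where "S = (\<Sum>n\<le>R. of_int (\<rho> n) * b ^ n)"
    assume "(\<Sum>n\<le>R. of_int (\<rho> n) * (1 / \<beta>) ^ n) \<noteq> 0"
    hence "S \<noteq> 0" by (simp add: S_def b_def)
    define X where "X = real (R + G + 2)"
    have "X \<ge> 2" by (simp add: X_def)
    \<comment> \<open>Reversing the coefficients gives \<open>q(\<beta>) = \<beta> ^ R * S\<close>,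
      an algebraic integer to which the conjugate bound applies.\<close>
    define q where "q = (\<Sum>n\<le>R. monom (\<rho> n) (R - n))"
    have q: "poly (map_poly of_int q) z = (\<Sum>n\<le>R. of_int (\<rho> n) * z ^ (R - n))" for z :: complex
      by (simp add: q_def hom_distribs poly_sum poly_monom)
    have q\<beta>: "poly (map_poly of_int q) (complex_of_real \<beta>) = complex_of_real (\<beta> ^ R * S)"
    proof -
      have "\<beta> ^ (R - n) = \<beta> ^ R * b ^ n" if "n \<le> R" for n
        using that assms(2) by (simp add: b_def power_diff power_one_over)
      thus ?thesis by (simp add: q S_def sum_distrib_left mult_ac flip: of_real_power)
    qed
    define T where "T = D * X ^ (e + 1)"
    have "T \<ge> 1" unfolding T_def using D(1) \<open>X \<ge> 2\<close>
      by (metis (no_types, lifting) dual_order.trans mult_mono one_le_numeral one_le_power mult_1 zero_le_one order.trans)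
    have qz: "cmod (poly (map_poly of_int q) z) \<le> T" if "z \<in> Z - {complex_of_real \<beta>}" for z
    proof -
      have z: "cmod z \<le> 1" using conj Z(3) that by auto
      have "cmod (poly (map_poly of_int q) z) \<le> (\<Sum>n\<le>R. cmod (of_int (\<rho> n) * z ^ (R - n)))"
        unfolding q by (rule norm_sum)
      also have "\<dots> \<le> (\<Sum>n\<le>R. D * X ^ e)"
      proof (rule sum_mono)
        fix n assume n: "n \<in> {..R}"
        have "cmod (of_int (\<rho> n) * z ^ (R - n)) \<le> \<bar>real_of_int (\<rho> n)\<bar> * 1"
          unfolding norm_mult norm_power by (intro mult_mono power_le_one) (use z in auto)
        also have "\<dots> \<le> D * real (n + 1) ^ e" using D(2) by simp
        also have "\<dots> \<le> D * X ^ e" using D(1) n by (intro mult_left_mono power_mono) (auto simp: X_def)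
        finally show "cmod (of_int (\<rho> n) * z ^ (R - n)) \<le> D * X ^ e" .
      qed
      also have "\<dots> = D * (real (R + 1) * X ^ e)" by simp
      also have "\<dots> \<le> D * (X * X ^ e)" 
        using D(1) by (intro mult_left_mono mult_right_mono) (auto simp: X_def)
      finally show ?thesis by (simp add: T_def)
    qed
    have "c \<le> (\<Prod>z\<in>Z. cmod (poly (map_poly of_int q) z))"
      by (rule c) (use \<open>S \<noteq> 0\<close> assms(2) in \<open>simp add: q\<beta> del: of_real_mult\<close>)
    also have "\<dots> = \<beta> ^ R * \<bar>S\<bar> * (\<Prod>z\<in>Z - {complex_of_real \<beta>}. cmod (poly (map_poly of_int q) z))"
      using Z(1,2) assms(2) by (simp add: prod.remove[of Z] q\<beta> norm_mult norm_power abs_mult del: of_real_mult)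
    also have "\<dots> \<le> \<beta> ^ R * \<bar>S\<bar> * T ^ r"
    proof -
      have "(\<Prod>z\<in>Z - {complex_of_real \<beta>}. cmod (poly (map_poly of_int q) z)) \<le> (\<Prod>z\<in>Z - {complex_of_real \<beta>}. T)"
        by (intro prod_mono) (use qz in auto)
      also have "\<dots> = T ^ r" using Z by (simp add: r_def)
      finally show ?thesis using assms(2) by (intro mult_left_mono) auto
    qed
    \<comment> \<open>\<open>S\<close> is minus the tail, which starts at \<open>R + G + 1\<close>.
      The 1 beyond the gap makes the final comparison with \<open>G\<close> strict.\<close>
    also have "\<bar>S\<bar> \<le> b ^ (R + G + 1) * X ^ e * K"
    proof -
      have zero': "(\<lambda>n. of_int (\<rho> n) * b ^ n) sums 0" using zero by (simp add: b_def)
      let ?N = "R + G + 1"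
      have "(\<Sum>n. of_int (\<rho> (n + ?N)) * b ^ (n + ?N)) = - (\<Sum>n<?N. of_int (\<rho> n) * b ^ n)"
        using suminf_split_initial_segment[OF sums_summable[OF zero'], of ?N] sums_unique[OF zero'] by linarith
      also have "(\<Sum>n<?N. of_int (\<rho> n) * b ^ n) = S"
        unfolding S_def by (rule sum.mono_neutral_right) (use gap in auto)
      finally have "\<bar>S\<bar> = \<bar>\<Sum>n. of_int (\<rho> (n + ?N)) * b ^ (n + ?N)\<bar>" by simp
      also have "\<dots> \<le> b ^ ?N * real (?N + 1) ^ e * (D * (\<Sum>n. real (n + 1) ^ e * b ^ n))"
        by (rule poly_growth_tail_bound) (use b D in auto)
      also have "?N + 1 = R + G + 2" by simp
      finally show ?thesis unfolding X_def K_def .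
    qed
    finally have "c \<le> \<beta> ^ R * (b ^ (R + G + 1) * X ^ e * K) * T ^ r"
      using assms(2) \<open>T \<ge> 1\<close> by (simp add: mult_left_mono mult_right_mono)
    also have "\<dots> = b ^ (G + 1) * (K * D ^ r) * X ^ E"
    proof -
      have "\<beta> ^ R * b ^ (R + G + 1) = b ^ (G + 1)"
        using b by (simp add: power_add flip: power_mult_distrib) (simp add: mult.commute flip: power_mult_distrib mult.assoc)
      moreover have "T ^ r * X ^ e = D ^ r * X ^ E"
        by (simp add: T_def E_def power_mult_distrib power_add power_mult mult_ac)
      ultimately show ?thesis by (simp only: mult_ac) (metis (no_types, lifting) mult.assoc mult.commute)
    qed
    finally have "1 \<le> b ^ (G + 1) * (K * D ^ r / c) * X ^ E"
      using \<open>c > 0\<close> by (simp add: field_simps)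
    also have "\<dots> \<le> b ^ (G + 1) * K' * X ^ E"
      using b(1) \<open>X \<ge> 2\<close> by (intro mult_left_mono mult_right_mono) (auto simp: K'_def)
    finally have "\<beta> ^ (G + 1) \<le> K' * X ^ E"
      using assms(2) by (simp add: b_def power_one_over field_simps)
    hence "ln (\<beta> ^ (G + 1)) \<le> ln (K' * X ^ E)"
      using assms(2) \<open>K' \<ge> 1\<close> \<open>X \<ge> 2\<close> by (subst ln_le_cancel_iff) auto
    hence "real (G + 1) * ln \<beta> \<le> ln K' + real E * ln X"
      using assms(2) \<open>K' \<ge> 1\<close> \<open>X \<ge> 2\<close> by (simp add: ln_realpow ln_mult algebra_simps)
    also have "ln K' \<le> ln K' / ln 2 * ln X"
    proof -
      have "ln K' / ln 2 * ln 2 \<le> ln K' / ln 2 * ln X"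
        using \<open>K' \<ge> 1\<close> \<open>X \<ge> 2\<close> by (intro mult_left_mono) auto
      thus ?thesis by simp
    qed
    finally have "real (G + 1) * ln \<beta> \<le> (ln K' / ln 2 + real E) * ln X" by (simp add: algebra_simps)
    also have "\<dots> \<le> B * ln \<beta> * ln X"
      using ln\<beta> \<open>X \<ge> 2\<close> by (simp add: B_def mult_right_mono)
    also have "\<dots> \<le> real G * ln \<beta>"
      using G ln\<beta> by (simp add: X_def mult_right_mono mult.commute mult.left_commute)
    finally show False using ln\<beta> by simp
  qed
  ultimately show ?thesis by blast
qed


section \<open>Sumsets of sparse sequences\<close>

text \<open>Models the exponents that occur in the \<open>k\<close>-th power of a series with
  nonnegative coefficients supported on \<open>S\<close>.\<close>

primrec nsum :: "nat set \<Rightarrow> nat \<Rightarrow> nat set" where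
  "nsum S 0 = {0}"
| "nsum S (Suc k) = (\<lambda>(a, b). a + b) ` (S \<times> nsum S k)"

definition separated :: "real \<Rightarrow> nat set \<Rightarrow> bool" where
  "separated d V \<longleftrightarrow> (\<forall>v\<in>V. \<forall>v'\<in>V. v < v' \<longrightarrow> real v + d \<le> real v')"

section \<open>Counting and pigeonhole for sumsets\<close>

lemma card_nsum_le:
  assumes "finite (S \<inter> {..N})"
  shows "finite (nsum S k \<inter> {..N}) \<and> card (nsum S k \<inter> {..N}) \<le> card (S \<inter> {..N}) ^ k"
proof (induction k)
  case 0
  show ?case by simp
next
  case (Suc k)
  have sub: "nsum S (Suc k) \<inter> {..N} \<subseteq> (\<lambda>(a, b). a + b) ` ((S \<inter> {..N}) \<times> (nsum S k \<inter> {..N}))"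
    by force
  have fin: "finite ((S \<inter> {..N}) \<times> (nsum S k \<inter> {..N}))" using assms Suc.IH by blast
  have "card (nsum S (Suc k) \<inter> {..N}) \<le> card ((S \<inter> {..N}) \<times> (nsum S k \<inter> {..N}))"
    using surj_card_le[OF fin sub] .
  also have "\<dots> = card (S \<inter> {..N}) * card (nsum S k \<inter> {..N})" by (rule card_cartesian_product)
  also have "\<dots> \<le> card (S \<inter> {..N}) ^ Suc k" using Suc.IH by simp
  finally show ?case using finite_subset[OF sub] fin by blast
qed

text \<open>The largest of the \<open>Suc k\<close> summands is at least their average. The others
  are kept as one element \<open>b\<close>, so that they can be counted while \<open>a\<close> is
  pinned down by the sparsity of large elements.\<close>

lemma nsum_large_summand:
  assumes "s \<in> nsum S (Suc k)"
  shows "\<exists>a\<in>S. \<exists>b\<in>nsum S k. s = a + b \<and> s \<le> Suc k * a"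
  using assms
proof (induction k arbitrary: s)
  case 0
  thus ?case by auto
next
  case (Suc k)
  then obtain a r where ar: "a \<in> S" "r \<in> nsum S (Suc k)" "s = a + r" by auto
  from Suc.IH[OF ar(2)] obtain a' b where a': "a' \<in> S" "b \<in> nsum S k" "r = a' + b" "r \<le> Suc k * a'"
    by blast
  show ?case
  proof (cases "a' \<le> a")
    case True
    have "r \<le> Suc k * a" using a'(4) True by (meson mult_le_mono2 order.trans)
    thus ?thesis using ar by (intro bexI[of _ a] bexI[of _ r]) auto
  next
    case False
    have "a + b \<in> nsum S (Suc k)" using ar(1) a'(2) by force
    moreover have "s = a' + (a + b)" using ar a' by simp
    moreover have "s \<le> Suc (Suc k) * a'" using False ar(3) a'(4) by simp
    ultimately show ?thesis using a'(1) by blast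
  qed
qed

text \<open>Each \<open>p\<close> spoils at most one \<open>v\<close>, because two points of
  \<open>V\<close> near the same \<open>p\<close> would be closer than \<open>d\<close>.\<close>

lemma card_close_points_le:
  assumes "finite P" "separated d V" "2 * L < d"
  shows "finite {v\<in>V. \<exists>p\<in>P. \<bar>real p - real v\<bar> \<le> L} \<and> card {v\<in>V. \<exists>p\<in>P. \<bar>real p - real v\<bar> \<le> L} \<le> card P"
proof -
  let ?B = "{v\<in>V. \<exists>p\<in>P. \<bar>real p - real v\<bar> \<le> L}"
  define f where "f = (\<lambda>v::nat. SOME p::nat. p \<in> P \<and> \<bar>real p - real v\<bar> \<le> L)"
  have f: "f v \<in> P" "\<bar>real (f v) - real v\<bar> \<le> L" if "v \<in> ?B" for v
  proof -
    have "\<exists>p. p \<in> P \<and> \<bar>real p - real v\<bar> \<le> L" using that by blast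
    from someI_ex[OF this] show "f v \<in> P" "\<bar>real (f v) - real v\<bar> \<le> L" by (auto simp: f_def)
  qed
  have lt: "f v \<noteq> f v'" if "v \<in> ?B" "v' \<in> ?B" "v < v'" for v v'
  proof
    assume "f v = f v'"
    with f(2)[OF that(1)] f(2)[OF that(2)] have "real v' - real v \<le> 2 * L" by linarith
    moreover have "real v + d \<le> real v'" using assms(2) that by (auto simp: separated_def)
    ultimately show False using assms(3) by linarith
  qed
  have inj: "inj_on f ?B"
  proof (rule inj_onI)
    fix v v' assume h: "v \<in> ?B" "v' \<in> ?B" "f v = f v'"
    show "v = v'" using lt[OF h(1,2)] lt[OF h(2,1)] h(3) by (cases v v' rule: linorder_cases) auto
  qed
  have sub: "f ` ?B \<subseteq> P" using f(1) by blast
  show ?thesis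
    using inj_on_finite[OF inj sub assms(1)] card_inj_on_le[OF inj sub assms(1)] by blast
qed

lemma exists_far_point:
  assumes "finite P" "separated d V" "2 * L < d" "card P < card V"
  shows "\<exists>v\<in>V. \<forall>p\<in>P. \<bar>real p - real v\<bar> > L"
proof (rule ccontr)
  assume "\<not> ?thesis"
  hence "{v\<in>V. \<exists>p\<in>P. \<bar>real p - real v\<bar> \<le> L} = V" by (force simp: not_less)
  with card_close_points_le[OF assms(1-3)] assms(4) show False by simp
qed

text \<open>Two kinds of \<open>v\<close> are bad. At most \<open>card P\<close> of them are near
  \<open>P\<close>; and as windows around separated points are disjoint, at most
  \<open>card A / c\<close> contain more than \<open>c\<close> points of \<open>A\<close>.\<close>

lemma exists_sparse_window:
  assumes "finite P" "finite A" "finite V" "separated d V" "2 * L < d"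
    and card: "card P + real (card A) / c < card V" and "c > 0"
  shows "\<exists>v\<in>V. (\<forall>p\<in>P. \<bar>real p - real v\<bar> > L) \<and> real (card {a\<in>A. \<bar>real a - real v\<bar> \<le> L}) \<le> c"
proof (rule ccontr)
  assume neg: "\<not> ?thesis"
  define B1 where "B1 = {v\<in>V. \<exists>p\<in>P. \<bar>real p - real v\<bar> \<le> L}"
  define w where "w = (\<lambda>v. {a\<in>A. \<bar>real a - real v\<bar> \<le> L})"
  define B2 where "B2 = {v\<in>V. real (card (w v)) > c}"
  have "V \<subseteq> B1 \<union> B2" using neg by (force simp: B1_def B2_def w_def not_less)
  hence "card V \<le> card (B1 \<union> B2)" by (rule card_mono[rotated]) (use assms(3) in \<open>auto simp: B1_def B2_def\<close>)
  also have "\<dots> \<le> card B1 + card B2" by (rule card_Un_le)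
  finally have le: "card V \<le> card B1 + card B2" .
  have B1: "card B1 \<le> card P" using card_close_points_le[OF assms(1,4,5)] by (simp add: B1_def)
  have disj: "w v \<inter> w v' = {}" if "v \<in> B2" "v' \<in> B2" "v < v'" for v v'
  proof -
    have "real v + d \<le> real v'" using assms(4) that by (auto simp: separated_def B2_def)
    thus ?thesis using assms(5) by (auto simp: w_def)
  qed
  have "c * card B2 = (\<Sum>v\<in>B2. c)" by simp
  also have "\<dots> \<le> (\<Sum>v\<in>B2. real (card (w v)))" by (intro sum_mono) (auto simp: B2_def)
  also have "\<dots> = real (card (\<Union>v\<in>B2. w v))"
  proof -
    have "card (\<Union>v\<in>B2. w v) = (\<Sum>v\<in>B2. card (w v))"
    proof (rule card_UN_disjoint)
      show "finite B2" using assms(3) by (simp add: B2_def)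
      show "\<forall>i\<in>B2. finite (w i)" using assms(2) by (simp add: w_def)
      show "\<forall>i\<in>B2. \<forall>j\<in>B2. i \<noteq> j \<longrightarrow> w i \<inter> w j = {}"
        using disj by (metis Int_commute linorder_neqE_nat)
    qed
    thus ?thesis by simp
  qed
  also have "\<dots> \<le> real (card A)" using assms(2) by (intro of_nat_mono card_mono) (auto simp: w_def)
  finally have "real (card B2) \<le> card A / c" using \<open>c > 0\<close> by (simp add: field_simps)
  with le B1 card show False by linarith
qed

text \<open>Pigeonhole on the \<open>m\<close> consecutive blocks of length \<open>G\<close> after
  \<open>a\<close>: they are disjoint, so one of them misses \<open>A\<close>.\<close>

lemma exists_gap:
  fixes A :: "nat set" and m G :: nat
  assumes "finite A" "card A < m"
  shows "\<exists>R\<ge>a. R + G \<le> a + m * G \<and> (\<forall>n. R < n \<and> n \<le> R + G \<longrightarrow> n \<notin> A)"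
proof (rule ccontr)
  assume neg: "\<not> ?thesis"
  have ex: "\<exists>n. n \<in> A \<and> a + i * G < n \<and> n \<le> a + Suc i * G" if "i < m" for i
  proof (rule ccontr)
    assume *: "\<nexists>n. n \<in> A \<and> a + i * G < n \<and> n \<le> a + Suc i * G"
    have "Suc i * G \<le> m * G" using that by (intro mult_le_mono1) auto
    hence "a + i * G \<ge> a \<and> a + i * G + G \<le> a + m * G \<and> (\<forall>n. a + i * G < n \<and> n \<le> a + i * G + G \<longrightarrow> n \<notin> A)"
      using * by (auto simp: algebra_simps)
    with neg show False by blast
  qed
  define f where "f = (\<lambda>i. SOME n. n \<in> A \<and> a + i * G < n \<and> n \<le> a + Suc i * G)"
  have f: "f i \<in> A" "a + i * G < f i" "f i \<le> a + Suc i * G" if "i < m" for i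
    using someI_ex[OF ex[OF that]] by (auto simp: f_def)
  have lt: "f i < f j" if "i < j" "j < m" for i j
  proof -
    have "f i \<le> a + Suc i * G" using f(3) that by simp
    also have "\<dots> \<le> a + j * G" using that by (intro add_left_mono mult_le_mono1) auto
    also have "\<dots> < f j" using f(2) that by simp
    finally show ?thesis .
  qed
  have "inj_on f {..<m}"
  proof (rule inj_onI)
    fix i j assume "i \<in> {..<m}" "j \<in> {..<m}" "f i = f j"
    thus "i = j" using lt[of i j] lt[of j i] by (cases i j rule: linorder_cases) auto
  qed
  hence "card {..<m} \<le> card A" by (rule card_inj_on_le) (use f(1) assms(1) in auto)
  with assms(2) show False by simp
qed

text \<open>\<open>W\<close> stands for \<open>t powr ln t\<close> or
  \<open>t powr ln (ln t)\<close>. Monotonicity of \<open>W t / t\<close> is a weak convexity that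
  yields both growth and gaps; \<open>spread\<close> says that raising the scale from
  \<open>t powr p\<close> to \<open>t powr r\<close> gains more than any power of \<open>t\<close>.
  The sequence starts at \<open>n0\<close>, but control begins only at \<open>T\<close>, where the
  exponent reaches 1, so finitely many initial terms may be irregular.\<close>

locale growth =
  fixes W :: "real \<Rightarrow> real" and n0 :: nat and T :: real
  assumes T: "T \<ge> 1"
    and W_ge_1: "t \<ge> T \<Longrightarrow> W t \<ge> 1"
    and div_mono: "T \<le> s \<Longrightarrow> s \<le> t \<Longrightarrow> W s / s \<le> W t / t"
    and W_at_top: "filterlim W at_top at_top"
    and spread: "0 < p \<Longrightarrow> p < r \<Longrightarrow> eventually (\<lambda>t. W (t powr p) * t powr c \<le> W (t powr r)) at_top"
begin

definition w :: "nat \<Rightarrow> nat" where "w n = nat \<lfloor>W (real n)\<rfloor>"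

definition S :: "nat set" where "S = w ` {n0..}"

lemma W_mono: "T \<le> s \<Longrightarrow> s \<le> t \<Longrightarrow> W s \<le> W t"
proof -
  assume st: "T \<le> s" "s \<le> t"
  have "W s = W s / s * s" using T st by simp
  also have "\<dots> \<le> W t / t * t"
    using div_mono[OF st] W_ge_1[of t] T st by (intro mult_mono) auto
  finally show "W s \<le> W t" using T st by simp
qed

lemma w_bounds: "real n \<ge> T \<Longrightarrow> real (w n) \<le> W n \<and> W n < real (w n) + 1"
  using W_ge_1[of "real n"] unfolding w_def by linarith

text \<open>Replacing \<open>W n / n\<close> by the smaller \<open>W m / m\<close> leaves
  \<open>W m / m\<close> times \<open>n - m\<close>, and \<open>n - m\<close> is at least 1.\<close>

lemma W_gap:
  assumes "T \<le> q" "q \<le> real m" "m < n"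
  shows "W (real n) - W (real m) \<ge> W q / q"
proof -
  have m0: "real m > 0" using T assms by linarith
  have "W q / q \<le> W m / m" using assms by (intro div_mono) auto
  also have "\<dots> \<le> W m / m * (real n - real m)"
    using assms m0 W_ge_1[of "real m"] mult_left_mono[of 1 "real n - real m" "W m / m"] by simp
  also have "\<dots> = W m / m * n - W m" using m0 by (simp add: field_simps)
  also have "\<dots> \<le> W n / n * n - W m"
    using assms div_mono[of m n] by (intro diff_right_mono mult_right_mono) auto
  also have "\<dots> = W n - W m" using assms by simp
  finally show ?thesis .
qed

lemma w_gap:
  assumes "T \<le> q" "q \<le> real m" "m < n"
  shows "real (w m) + (W q / q - 1) \<le> real (w n)"
  using W_gap[OF assms] w_bounds[of m] w_bounds[of n] assms by linarith

text \<open>An index \<open>n \<ge> q\<close> has \<open>W n \<ge> N + 1\<close>, so even after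
  taking the floor its value exceeds \<open>N\<close>. Only indices up to \<open>q\<close> remain,
  and these include the irregular ones below \<open>T\<close>.\<close>

lemma card_S_le:
  assumes "T \<le> q" "real N + 1 \<le> W q"
  shows "finite (S \<inter> {..N}) \<and> real (card (S \<inter> {..N})) \<le> q + 1"
proof -
  have "S \<inter> {..N} \<subseteq> w ` {..nat \<lfloor>q\<rfloor>}"
  proof
    fix s assume "s \<in> S \<inter> {..N}"
    then obtain n where n: "s = w n" "w n \<le> N" by (auto simp: S_def)
    have "real n < q"
    proof (rule ccontr)
      assume "\<not> real n < q"
      hence "W q \<le> W n" "real n \<ge> T" using assms(1) by (auto intro: W_mono)
      with w_bounds[of n] assms(2) n show False by linarith
    qed
    hence "n \<le> nat \<lfloor>q\<rfloor>" by linarith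
    thus "s \<in> w ` {..nat \<lfloor>q\<rfloor>}" using n by blast
  qed
  moreover from this have "card (S \<inter> {..N}) \<le> card {..nat \<lfloor>q\<rfloor>}"
    by (rule surj_card_le[rotated]) simp
  moreover have "real (card {..nat \<lfloor>q\<rfloor>}) \<le> q + 1" using assms(1) T by simp
  ultimately show ?thesis by (auto intro: finite_subset)
qed

text \<open>Above \<open>T\<close> this is monotonicity; the finitely many irregular values below
  \<open>T\<close> are eventually exceeded by \<open>W q\<close>. Read backwards, it turns a large
  value of \<open>w\<close> into a large index.\<close>

lemma eventually_w_le_W: "eventually (\<lambda>q. \<forall>n. real n \<le> q \<longrightarrow> real (w n) \<le> W q) at_top"
proof -
  define m where "m = (\<Sum>n\<le>nat \<lceil>T\<rceil>. real (w n))"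
  have "eventually (\<lambda>q. W q \<ge> m) at_top" using W_at_top by (simp add: filterlim_at_top)
  thus ?thesis
  proof eventually_elim
    case (elim q)
    show ?case
    proof (intro allI impI)
      fix n assume "real n \<le> q"
      show "real (w n) \<le> W q"
      proof (cases "real n \<ge> T")
        case True
        thus ?thesis using w_bounds[of n] W_mono[of n q] \<open>real n \<le> q\<close> by linarith
      next
        case False
        hence "n \<in> {..nat \<lceil>T\<rceil>}" by simp linarith
        hence "real (w n) \<le> m" unfolding m_def by (intro member_le_sum) auto
        thus ?thesis using elim by linarith
      qed
    qed
  qed
qed

text \<open>
  The summand added in the induction step is \<open>w n\<close> with \<open>n\<close> near $t^{1 + 3\eta/4}$, where the gaps of
  \<open>w\<close> already exceed $W(t^{1 + \eta/2})$, the bound for the sums constructed before.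
\<close>

lemma separated_sums:
  assumes "\<eta> > 0"
  shows "eventually (\<lambda>t. \<exists>V. finite V \<and> V \<subseteq> nsum S k \<and> (\<forall>v\<in>V. real v \<le> W (t powr (1 + \<eta>))) \<and>
      t ^ k \<le> real (card V) \<and> separated (W t / t) V) at_top"
  using assms
proof (induction k arbitrary: \<eta>)
  case 0
  have "eventually (\<lambda>t. t \<ge> T) at_top" by (rule eventually_ge_at_top)
  moreover have "eventually (\<lambda>t. t powr (1 + \<eta>) \<ge> T) at_top"
    using 0 by real_asymp
  ultimately show ?case
  proof eventually_elim
    case (elim t)
    show ?case
      by (rule exI[of _ "{0}"]) (use W_ge_1[OF elim(2)] in \<open>auto simp: separated_def\<close>)
  qed
next
  case (Suc k)
  define p1 where "p1 = 1 + \<eta> / 2"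
  define p2 where "p2 = 1 + 3 * \<eta> / 4"
  \<comment> \<open>\<open>p3\<close> leaves room for indices up to \<open>2 * q\<close>, and the
    step from \<open>p3\<close> to \<open>p4\<close> for adding two numbers of size at most
    \<open>W (t powr p3)\<close>.\<close>
  define p3 where "p3 = 1 + 7 * \<eta> / 8"
  define p4 where "p4 = 1 + \<eta>"
  have p: "1 < p1" "p1 < p2" "p2 < p3" "p3 < p4" using Suc.prems by (auto simp: p1_def p2_def p3_def p4_def)
  have "eventually (\<lambda>t. \<exists>V. finite V \<and> V \<subseteq> nsum S k \<and> (\<forall>v\<in>V. real v \<le> W (t powr p1)) \<and>
      t ^ k \<le> real (card V) \<and> separated (W t / t) V) at_top"
    unfolding p1_def using Suc.prems by (intro Suc.IH) auto
  moreover have "eventually (\<lambda>t::real. real n0 \<le> t \<and> T \<le> t \<and> 3 \<le> t) at_top"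
    by (intro eventually_conj eventually_ge_at_top)
  moreover have "eventually (\<lambda>t. t \<le> t powr p1 \<and> t \<le> t powr p2 \<and> 2 * (t powr p2 + 1) \<le> t powr p3) at_top"
    using p by (intro eventually_conj) real_asymp+
  moreover have "eventually (\<lambda>t. W (t powr p1) * t powr (p2 + 1) \<le> W (t powr p2)) at_top"
    using p by (intro spread) auto
  moreover have "eventually (\<lambda>t. W (t powr p3) * t powr 1 \<le> W (t powr p4)) at_top"
    using p by (intro spread) auto
  ultimately have "eventually (\<lambda>t. \<exists>V. finite V \<and> V \<subseteq> nsum S (Suc k) \<and> (\<forall>v\<in>V. real v \<le> W (t powr p4)) \<and>
      t ^ Suc k \<le> real (card V) \<and> separated (W t / t) V) at_top"
  proof eventually_elim
    case (elim t)
    from elim(1) obtain V where V: "finite V" "V \<subseteq> nsum S k" "\<And>v. v \<in> V \<Longrightarrow> real v \<le> W (t powr p1)"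
      "t ^ k \<le> real (card V)" "separated (W t / t) V" by blast
    define q where "q = nat \<lceil>t powr p2\<rceil>"
    have t: "t \<ge> 3" "t \<ge> T" using elim(2) by auto
    have q: "t powr p2 \<le> real q" "real q \<le> t powr p2 + 1" unfolding q_def by (auto simp: of_nat_ceiling)
    have tq: "t \<le> real q" using elim(3) q by linarith
    \<comment> \<open>The \<open>q \<ge> t\<close> choices of the new index provide the factor
      \<open>t\<close> in the count.\<close>
    define I where "I = {q<..2*q}"
    define V' where "V' = (\<lambda>(n, v). w n + v) ` (I \<times> V)"
    have W1: "1 \<le> W (t powr p1)" using W_ge_1[of "t powr p1"] elim(3) t by auto
    have Wt: "W t / t \<le> W (t powr p1)" "W t / t > 0"
    proof -
      have "W t / t \<le> W t" using t W_ge_1[of t] by (simp add: field_simps)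
      also have "\<dots> \<le> W (t powr p1)" using t elim(3) by (intro W_mono) auto
      finally show "W t / t \<le> W (t powr p1)" .
      show "W t / t > 0" using t W_ge_1[of t] by (intro divide_pos_pos) auto
    qed
    \<comment> \<open>The factor 3 pays for an earlier sum \<open>v\<close>, for the required
      separation \<open>W t / t\<close> and for the loss of 1 from the floor, each at most
      \<open>W (t powr p1)\<close>.\<close>
    have "3 * W (t powr p1) \<le> W (t powr p2) / t powr p2"
    proof -
      have "W (t powr p1) * 3 * t powr p2 \<le> W (t powr p1) * t * t powr p2"
        using t W1 by (intro mult_right_mono mult_left_mono) auto
      also have "\<dots> \<le> W (t powr p2)" using elim(4) t by (simp add: powr_add mult_ac)
      finally show ?thesis using t by (simp add: field_simps)
    qed
    also have "\<dots> \<le> W q / q" using q elim(3) t by (intro div_mono) auto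
    finally have Wq: "3 * W (t powr p1) \<le> W q / q" .
    have diff: "real (w n + v) + W t / t \<le> real (w n' + v')"
      if "n \<in> I" "n' \<in> I" "v \<in> V" "v' \<in> V" "n < n'" for n n' v v'
    proof -
      have "real (w n) + (W q / q - 1) \<le> real (w n')"
        by (rule w_gap) (use that tq t in \<open>auto simp: I_def\<close>)
      with Wq W1 Wt V(3)[OF that(3)] show ?thesis by simp
    qed
    have inj: "inj_on (\<lambda>(n, v). w n + v) (I \<times> V)"
    proof (rule inj_onI)
      fix x y assume *: "x \<in> I \<times> V" "y \<in> I \<times> V" "(\<lambda>(n, v). w n + v) x = (\<lambda>(n, v). w n + v) y"
      obtain n v n' v' where xy: "x = (n, v)" "y = (n', v')" by (cases x, cases y) auto
      have "n = n'"
        using diff[of n n' v v'] diff[of n' n v' v] * xy Wt(2) by (cases n n' rule: linorder_cases) auto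
      thus "x = y" using * xy by auto
    qed
    show ?case
    proof (intro exI[of _ V'] conjI ballI)
      show "finite V'" using V(1) by (simp add: V'_def I_def)
      have "w n \<in> S" if "n \<in> I" for n
        using that elim(2) tq unfolding S_def I_def by (intro imageI) auto
      thus "V' \<subseteq> nsum S (Suc k)" using V(2) unfolding V'_def by fastforce
      have "t ^ Suc k \<le> real q * real (card V)"
        using V(4) tq t by (auto intro!: mult_mono)
      also have "\<dots> = real (card V')"
        using inj by (simp add: V'_def card_image card_cartesian_product I_def)
      finally show "t ^ Suc k \<le> real (card V')" .
      show "separated (W t / t) V'"
        unfolding separated_def
      proof (intro ballI impI)
        fix x y assume "x \<in> V'" "y \<in> V'" "x < y"
        then obtain n v n' v' where nv: "n \<in> I" "v \<in> V" "n' \<in> I" "v' \<in> V" "x = w n + v" "y = w n' + v'"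
          by (auto simp: V'_def)
        show "real x + W t / t \<le> real y"
        proof (cases n n' rule: linorder_cases)
          case less
          thus ?thesis using diff nv by blast
        next
          case equal
          hence "v < v'" using nv \<open>x < y\<close> by simp
          thus ?thesis using V(5) nv equal by (auto simp: separated_def)
        next
          case greater
          hence "real y + W t / t \<le> real x" using diff nv by blast
          with \<open>x < y\<close> Wt(2) show ?thesis by linarith
        qed
      qed
      fix x assume "x \<in> V'"
      then obtain n v where nv: "n \<in> I" "v \<in> V" "x = w n + v" by (auto simp: V'_def)
      have n: "T \<le> real n" "real n \<le> t powr p3"
      proof -
        have "n > q" "n \<le> 2 * q" using nv by (auto simp: I_def)
        hence nq: "real n > real q" "real n \<le> 2 * real q" by linarith+
        show "T \<le> real n" using nq(1) tq t by linarith
        have "real n \<le> 2 * (t powr p2 + 1)" using mult_left_mono[OF q(2), of 2] nq(2) by (auto intro: order_trans)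
        also have "\<dots> \<le> t powr p3" using elim(3) by blast
        finally show "real n \<le> t powr p3" .
      qed
      hence "real (w n) \<le> W (t powr p3)" using w_bounds[of n] W_mono[of n "t powr p3"] by linarith
      moreover have "W (t powr p1) \<le> W (t powr p3)"
        using p t elim(3) by (intro W_mono powr_mono) auto
      ultimately have "real x \<le> W (t powr p3) * 2" using V(3)[OF nv(2)] nv(3) by simp
      also have "\<dots> \<le> W (t powr p3) * t"
        using t n W_ge_1[of "t powr p3"] by (intro mult_left_mono) auto
      also have "\<dots> \<le> W (t powr p4)" using elim(5) t by simp
      finally show "real x \<le> W (t powr p4)" .
    qed
  qed
  thus ?case by (simp add: p4_def)
qed

end


text \<open>These are the exponents that occur in the monomial of degree \<open>i\<close> in the
  first series and \<open>j\<close> in the second.\<close>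

definition mixed_sums :: "nat set \<Rightarrow> nat set \<Rightarrow> nat \<Rightarrow> nat \<Rightarrow> nat set" where
  "mixed_sums S1 S2 i j = (\<lambda>(a, b). a + b) ` (nsum S1 i \<times> nsum S2 j)"

lemma card_mixed_sums_le:
  assumes "finite (S1 \<inter> {..N})" "finite (S2 \<inter> {..N})"
    and "real (card (S1 \<inter> {..N})) \<le> \<kappa>1" "real (card (S2 \<inter> {..N})) \<le> \<kappa>2"
  shows "finite (mixed_sums S1 S2 i j \<inter> {..N})" "real (card (mixed_sums S1 S2 i j \<inter> {..N})) \<le> \<kappa>1 ^ i * \<kappa>2 ^ j"
proof -
  let ?P = "(nsum S1 i \<inter> {..N}) \<times> (nsum S2 j \<inter> {..N})"
  have sub: "mixed_sums S1 S2 i j \<inter> {..N} \<subseteq> (\<lambda>(a, b). a + b) ` ?P"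
    unfolding mixed_sums_def by force
  have n1: "finite (nsum S1 i \<inter> {..N})" "card (nsum S1 i \<inter> {..N}) \<le> card (S1 \<inter> {..N}) ^ i"
    using card_nsum_le[OF assms(1)] by auto
  have n2: "finite (nsum S2 j \<inter> {..N})" "card (nsum S2 j \<inter> {..N}) \<le> card (S2 \<inter> {..N}) ^ j"
    using card_nsum_le[OF assms(2)] by auto
  have fin: "finite ?P" using n1 n2 by blast
  show "finite (mixed_sums S1 S2 i j \<inter> {..N})" using finite_subset[OF sub] fin by blast
  have "card (mixed_sums S1 S2 i j \<inter> {..N}) \<le> card ?P" using surj_card_le[OF fin sub] .
  also have "\<dots> \<le> card (S1 \<inter> {..N}) ^ i * card (S2 \<inter> {..N}) ^ j"
    unfolding card_cartesian_product by (rule mult_le_mono[OF n1(2) n2(2)])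
  finally have "real (card (mixed_sums S1 S2 i j \<inter> {..N})) \<le> real (card (S1 \<inter> {..N})) ^ i * real (card (S2 \<inter> {..N})) ^ j"
    by (metis of_nat_le_iff of_nat_mult of_nat_power)
  also have "\<dots> \<le> \<kappa>1 ^ i * \<kappa>2 ^ j"
    using assms(3,4) by (intro mult_mono power_mono) (auto intro: order_trans[OF of_nat_0_le_iff] zero_le_power)
  finally show "real (card (mixed_sums S1 S2 i j \<inter> {..N})) \<le> \<kappa>1 ^ i * \<kappa>2 ^ j" .
qed

text \<open>
  The point \<open>u = v + s\<close> is chosen in two steps: \<open>v \<in> V1\<close> far from all shorter sums of \<open>S1\<close>, then \<open>s \<in> V2\<close>.
  A sum of type \<open>(i, D)\<close> with \<open>i < k\<close> near \<open>u\<close> has a large part in \<open>nsum S2 D\<close>; its largest summand is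
  determined by the other summands, because \<open>S2\<close> is sparse there (assumption \<open>big\<close>). Hence it counts like a
  sum of only \<open>D - 1\<close> elements of \<open>S2\<close>.
\<close>

lemma isolated_cluster_from_counts:
  fixes S1 S2 V1 V2 :: "nat set" and H L M b1 c d1 d2 \<kappa>1 \<kappa>2 :: real and N G K k D :: nat
  assumes kD: "k \<ge> 1" "D \<ge> 1"
    and c1: "finite (S1 \<inter> {..N})" "real (card (S1 \<inter> {..N})) \<le> \<kappa>1" "1 \<le> \<kappa>1"
    and c2: "finite (S2 \<inter> {..N})" "real (card (S2 \<inter> {..N})) \<le> \<kappa>2" "1 \<le> \<kappa>2"
    and V1: "V1 \<subseteq> nsum S1 k" "\<And>v. v \<in> V1 \<Longrightarrow> real v \<le> b1" "k * \<kappa>1 ^ (k - 1) < card V1"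
      "separated d1 V1" "2 * H < d1"
    and V2: "finite V2" "V2 \<subseteq> nsum S2 D" "\<And>s. s \<in> V2 \<Longrightarrow> real s \<le> M" "separated d2 V2" "2 * L < d2"
    and big: "\<And>\<sigma> \<sigma>'. \<sigma> \<in> S2 \<Longrightarrow> \<sigma>' \<in> S2 \<Longrightarrow> \<sigma> < \<sigma>' \<Longrightarrow> H - L \<le> D * real \<sigma> \<Longrightarrow> real \<sigma> + M + 2 * L < real \<sigma>'"
    and sizes: "b1 + H \<le> N" "b1 + M + L \<le> N" "M + L \<le> H" "0 \<le> M"
    and card: "(K + 1) * D * \<kappa>1 ^ K * \<kappa>2 ^ (D - 1) + k * \<kappa>1 ^ (k - 1) * \<kappa>2 ^ (D - 1) + \<kappa>1 ^ k * \<kappa>2 ^ D / c < card V2"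
    and c: "c > 0" "(c + 1) * G + 1 \<le> L"
  shows "\<exists>u R1 R2. u \<in> mixed_sums S1 S2 k D \<and> R1 + G < u \<and> u \<le> R2 \<and> R2 + G \<le> N \<and>
    (\<forall>n i j. R1 < n \<and> n \<le> R2 + G \<longrightarrow> j < D \<and> i \<le> K \<or> j = D \<and> i < k \<longrightarrow> n \<notin> mixed_sums S1 S2 i j) \<and>
    (\<forall>n. R1 < n \<and> n \<le> R1 + G \<or> R2 < n \<and> n \<le> R2 + G \<longrightarrow> n \<notin> mixed_sums S1 S2 k D)"
proof -
  have L0: "L \<ge> 0" "L \<ge> 1" using c by (smt (verit) mult_nonneg_nonneg of_nat_0_le_iff)+
  define P1 where "P1 = (\<Union>i<k. nsum S1 i \<inter> {..N})"
  have P1: "finite P1" "real (card P1) \<le> k * \<kappa>1 ^ (k - 1)"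
  proof -
    have n: "finite (nsum S1 i \<inter> {..N})" "card (nsum S1 i \<inter> {..N}) \<le> card (S1 \<inter> {..N}) ^ i" for i
      using card_nsum_le[OF c1(1)] by auto
    show "finite P1" unfolding P1_def using n by blast
    have "real (card P1) \<le> (\<Sum>i<k. real (card (nsum S1 i \<inter> {..N})))"
      unfolding P1_def using card_UN_le[of "{..<k}" "\<lambda>i. nsum S1 i \<inter> {..N}"]
      by (subst of_nat_sum [symmetric], subst of_nat_le_iff) simp
    also have "\<dots> \<le> (\<Sum>i<k. \<kappa>1 ^ (k - 1))"
    proof (rule sum_mono)
      fix i assume i: "i \<in> {..<k}"
      have "real (card (nsum S1 i \<inter> {..N})) \<le> real (card (S1 \<inter> {..N})) ^ i"
        using n(2)[of i] by (metis of_nat_le_iff of_nat_power)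
      also have "\<dots> \<le> \<kappa>1 ^ i" using c1 by (intro power_mono) auto
      also have "\<dots> \<le> \<kappa>1 ^ (k - 1)" using c1(3) i by (intro power_increasing) auto
      finally show "real (card (nsum S1 i \<inter> {..N})) \<le> \<kappa>1 ^ (k - 1)" .
    qed
    finally show "real (card P1) \<le> k * \<kappa>1 ^ (k - 1)" by simp
  qed
  have "card P1 < card V1" using P1(2) V1(3) by linarith
  then obtain v where v: "v \<in> V1" "\<And>p. p \<in> P1 \<Longrightarrow> \<bar>real p - real v\<bar> > H"
    using exists_far_point[OF P1(1) V1(4,5)] by blast
  \<comment> \<open>The empty sum is among the shorter sums, so \<open>v\<close> exceeds
    \<open>H\<close>; this leaves room for the gap to the left of \<open>u\<close>.\<close>
  have "0 \<in> P1" using kD unfolding P1_def by (auto intro!: bexI[of _ 0])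
  hence vH: "real v > H" using v(2)[of 0] by simp
  have vb: "real v \<le> b1" using V1(2) v(1) by blast
  define P2 where "P2 = (\<Union>(i, j)\<in>{..K} \<times> {..<D}. mixed_sums S1 S2 i j \<inter> {..N})"
  have P2: "finite P2" "real (card P2) \<le> (K + 1) * D * \<kappa>1 ^ K * \<kappa>2 ^ (D - 1)"
  proof -
    show "finite P2" unfolding P2_def using card_mixed_sums_le(1)[OF c1(1) c2(1) c1(2) c2(2)] by auto
    have "real (card P2) \<le> (\<Sum>x\<in>{..K} \<times> {..<D}. real (card (case x of (i, j) \<Rightarrow> mixed_sums S1 S2 i j \<inter> {..N})))"
      unfolding P2_def using card_UN_le[of "{..K} \<times> {..<D}" "\<lambda>(i, j). mixed_sums S1 S2 i j \<inter> {..N}"]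
      by (subst of_nat_sum [symmetric], subst of_nat_le_iff) simp
    also have "\<dots> \<le> (\<Sum>x\<in>{..K} \<times> {..<D}. \<kappa>1 ^ K * \<kappa>2 ^ (D - 1))"
    proof (rule sum_mono)
      fix x assume "x \<in> {..K} \<times> {..<D}"
      then obtain i j where x: "x = (i, j)" "i \<le> K" "j \<le> D - 1" by auto
      have "real (card (mixed_sums S1 S2 i j \<inter> {..N})) \<le> \<kappa>1 ^ i * \<kappa>2 ^ j"
        by (rule card_mixed_sums_le(2)[OF c1(1) c2(1) c1(2) c2(2)])
      also have "\<dots> \<le> \<kappa>1 ^ K * \<kappa>2 ^ (D - 1)"
        using c1(3) c2(3) x by (intro mult_mono power_increasing) auto
      finally show "real (card (case x of (i, j) \<Rightarrow> mixed_sums S1 S2 i j \<inter> {..N})) \<le> \<kappa>1 ^ K * \<kappa>2 ^ (D - 1)"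
        using x by simp
    qed
    finally show "real (card P2) \<le> (K + 1) * D * \<kappa>1 ^ K * \<kappa>2 ^ (D - 1)" by simp
  qed
  define good where "good = (\<lambda>\<tau> (e, b) \<sigma>. e \<in> P1 \<and> b \<in> nsum S2 (D - 1) \<inter> {..N} \<and> \<sigma> \<in> S2 \<and>
    H - L \<le> D * real \<sigma> \<and> \<tau> = e + (\<sigma> + b))"
  \<comment> \<open>Every window around a point of \<open>v + V2\<close> lies in this interval of
    length \<open>M + 2 * L\<close>. For fixed \<open>(e, b)\<close>, two choices of
    \<open>\<sigma>\<close> would differ by more than this length.\<close>
  define P3 where "P3 = {\<tau>. real v - L \<le> real \<tau> \<and> real \<tau> \<le> real v + M + L \<and> (\<exists>x \<sigma>. good \<tau> x \<sigma>)}"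
  define f where "f = (\<lambda>\<tau>. SOME x. \<exists>\<sigma>. good \<tau> x \<sigma>)"
  have f: "\<exists>\<sigma>. good \<tau> (f \<tau>) \<sigma>" if "\<tau> \<in> P3" for \<tau>
    unfolding f_def by (rule someI_ex) (use that in \<open>auto simp: P3_def\<close>)
  have P3: "finite P3" "real (card P3) \<le> k * \<kappa>1 ^ (k - 1) * \<kappa>2 ^ (D - 1)"
  proof -
    let ?Q = "P1 \<times> (nsum S2 (D - 1) \<inter> {..N})"
    have n: "finite (nsum S2 (D - 1) \<inter> {..N})" "card (nsum S2 (D - 1) \<inter> {..N}) \<le> card (S2 \<inter> {..N}) ^ (D - 1)"
      using card_nsum_le[OF c2(1)] by auto
    have inj: "inj_on f P3"
    proof (rule inj_onI)
      fix x y assume xy: "x \<in> P3" "y \<in> P3" "f x = f y"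
      obtain e b where eb: "f x = (e, b)" by (cases "f x")
      have "\<exists>\<sigma>. good x (e, b) \<sigma>" "\<exists>\<sigma>. good y (e, b) \<sigma>" 
        using f[OF xy(1)] f[OF xy(2)] xy(3) eb by auto
      then obtain \<sigma> \<sigma>' where \<sigma>: "good x (e, b) \<sigma>" "good y (e, b) \<sigma>'" by blast
      have close: "\<bar>real x - real y\<bar> \<le> M + 2 * L" using xy(1,2) by (auto simp: P3_def)
      have "\<sigma> = \<sigma>'"
        using big[of \<sigma> \<sigma>'] big[of \<sigma>' \<sigma>] \<sigma> close by (cases \<sigma> \<sigma>' rule: linorder_cases) (auto simp: good_def)
      thus "x = y" using \<sigma> by (simp add: good_def)
    qed
    have sub: "f ` P3 \<subseteq> ?Q"
    proof
      fix y assume "y \<in> f ` P3"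
      then obtain x \<sigma> where "y = f x" "good x y \<sigma>" using f by blast
      thus "y \<in> ?Q" by (auto simp: good_def split: prod.splits)
    qed
    have fin: "finite ?Q" using P1(1) n(1) by blast
    show "finite P3" by (rule inj_on_finite[OF inj sub fin])
    have "card P3 \<le> card ?Q" by (rule card_inj_on_le[OF inj sub fin])
    also have "\<dots> = card P1 * card (nsum S2 (D - 1) \<inter> {..N})" by (rule card_cartesian_product)
    finally have "real (card P3) \<le> real (card P1) * real (card (nsum S2 (D - 1) \<inter> {..N}))"
      by (metis of_nat_le_iff of_nat_mult)
    also have "\<dots> \<le> (k * \<kappa>1 ^ (k - 1)) * \<kappa>2 ^ (D - 1)"
    proof (rule mult_mono)
      have "real (card (nsum S2 (D - 1) \<inter> {..N})) \<le> real (card (S2 \<inter> {..N})) ^ (D - 1)"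
        using n(2) by (metis of_nat_le_iff of_nat_power)
      also have "\<dots> \<le> \<kappa>2 ^ (D - 1)" using c2 by (intro power_mono) auto
      finally show "real (card (nsum S2 (D - 1) \<inter> {..N})) \<le> \<kappa>2 ^ (D - 1)" .
    qed (use P1(2) c1(3) in auto)
    finally show "real (card P3) \<le> k * \<kappa>1 ^ (k - 1) * \<kappa>2 ^ (D - 1)" .
  qed
  define A where "A = mixed_sums S1 S2 k D \<inter> {..N}"
  have A: "finite A" "real (card A) \<le> \<kappa>1 ^ k * \<kappa>2 ^ D"
    unfolding A_def using card_mixed_sums_le[OF c1(1) c2(1) c1(2) c2(2)] by auto
  define V where "V = (+) v ` V2"
  have sepV: "separated d2 V" using V2(4) unfolding separated_def V_def by auto
  have finV: "finite V" unfolding V_def using V2(1) by simp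
  have cardV: "card V = card V2" unfolding V_def by (intro card_image) auto
  have "real (card (P2 \<union> P3)) \<le> real (card P2) + real (card P3)"
    by (metis card_Un_le of_nat_add of_nat_le_iff)
  moreover have "real (card A) / c \<le> \<kappa>1 ^ k * \<kappa>2 ^ D / c" using A c(1) by (intro divide_right_mono) auto
  ultimately have "card (P2 \<union> P3) + real (card A) / c < card V"
    using P2(2) P3(2) card cardV by linarith
  then obtain u where u: "u \<in> V" "\<And>p. p \<in> P2 \<union> P3 \<Longrightarrow> \<bar>real p - real u\<bar> > L"
      "real (card {a\<in>A. \<bar>real a - real u\<bar> \<le> L}) \<le> c"
    using exists_sparse_window[of "P2 \<union> P3" A V d2 L c] P2(1) P3(1) A(1) V2(5) sepV c(1) finV by blast
  obtain s where s: "s \<in> V2" "u = v + s" using u(1) by (auto simp: V_def)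
  have uA: "u \<in> mixed_sums S1 S2 k D"
    unfolding mixed_sums_def s(2) using V1(1) V2(2) v(1) s(1) by force
  have sM: "real s \<le> M" using V2(3) s(1) by blast
  have near_le: "n \<le> N" if "\<bar>real n - real u\<bar> \<le> L" for n
    using that s(2) sM vb sizes(2) by linarith
  have no_T: "n \<notin> mixed_sums S1 S2 i j"
    if n: "\<bar>real n - real u\<bar> \<le> L" and ij: "j < D \<and> i \<le> K \<or> j = D \<and> i < k" for n i j
  proof
    assume mem: "n \<in> mixed_sums S1 S2 i j"
    show False
    proof (cases "j < D \<and> i \<le> K")
      case True
      hence "n \<in> P2" unfolding P2_def using mem near_le[OF n] by blast
      thus False using u(2)[of n] n by simp
    next
      case False
      hence j: "j = D" "i < k" using ij by auto
      obtain e s' where e: "e \<in> nsum S1 i" "s' \<in> nsum S2 D" "n = e + s'"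
        using mem j unfolding mixed_sums_def by auto
      have "e \<in> P1" using e j near_le[OF n] unfolding P1_def by auto
      hence eH: "\<bar>real e - real v\<bar> > H" by (rule v(2))
      have nv: "real v - L \<le> real n" "real n \<le> real v + M + L"
        using n s(2) sM by linarith+
      \<comment> \<open>\<open>e\<close> cannot exceed \<open>v + H\<close>, because
        \<open>e \<le> n\<close>. So it falls short of \<open>v\<close> by more than
        \<open>H\<close>, and \<open>s'\<close> has to make up for it.\<close>
      have "real e \<le> real v + H" using e(3) nv sizes(3) by linarith
      hence "real e < real v - H" using eH by linarith
      hence s': "real s' \<ge> H - L" using e(3) nv by linarith
      obtain D' where D': "D = Suc D'" using kD(2) by (cases D) auto
      obtain a b where ab: "a \<in> S2" "b \<in> nsum S2 D'" "s' = a + b" "s' \<le> D * a"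
        using nsum_large_summand[of s' S2 D'] e(2) D' by blast
      have "real s' \<le> D * real a" using ab(4) by (metis of_nat_le_iff of_nat_mult)
      hence "good n (e, b) a"
        using \<open>e \<in> P1\<close> ab e near_le[OF n] s' D' unfolding good_def by auto
      hence "n \<in> P3" using nv unfolding P3_def by blast
      thus False using u(2)[of n] n by simp
    qed
  qed
  define A' where "A' = {a\<in>A. \<bar>real a - real u\<bar> \<le> L}"
  \<comment> \<open>\<open>A'\<close> has fewer than \<open>m\<close> points, and \<open>m\<close>
    blocks of length \<open>G\<close> fit inside the window on either side of \<open>u\<close>. The
    additional 1 lets the left search end at \<open>u - 1\<close>.\<close>
  define m where "m = nat \<lfloor>c\<rfloor> + 1"
  have m: "card A' < m" "real m \<le> c + 1" unfolding m_def using u(3) c(1) by (auto simp: A'_def) linarith+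
  have "real (m * G + 1) \<le> (c + 1) * G + 1" using m(2) by (simp add: mult_right_mono)
  also have "\<dots> \<le> L" by (rule c(2))
  finally have mG: "real (m * G + 1) \<le> L" .
  have finA': "finite A'" using A(1) by (simp add: A'_def)
  have uL: "real u \<ge> L" using s(2) vH sizes(3,4) by linarith
  hence "m * G + 1 \<le> u" using mG by linarith
  obtain R1 where R1: "R1 \<ge> u - 1 - m * G" "R1 + G \<le> u - 1 - m * G + m * G"
      "\<And>n. R1 < n \<Longrightarrow> n \<le> R1 + G \<Longrightarrow> n \<notin> A'"
    using exists_gap[OF finA' m(1)] by blast
  obtain R2 where R2: "R2 \<ge> u" "R2 + G \<le> u + m * G" "\<And>n. R2 < n \<Longrightarrow> n \<le> R2 + G \<Longrightarrow> n \<notin> A'"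
    using exists_gap[OF finA' m(1)] by blast
  have near: "\<bar>real n - real u\<bar> \<le> L" if "R1 < n" "n \<le> R2 + G" for n
  proof -
    have "n \<le> u + m * G" using that R2 by linarith
    moreover have "u \<le> n + (m * G + 1)" using that R1 by linarith
    ultimately have "real n \<le> real u + real (m * G)" "real u \<le> real n + real (m * G + 1)"
      by (metis of_nat_add of_nat_le_iff)+
    thus ?thesis using mG by simp
  qed
  have R1u: "R1 + G < u" using R1(2) \<open>m * G + 1 \<le> u\<close> by linarith
  show ?thesis
  proof (rule exI[of _ u], rule exI[of _ R1], rule exI[of _ R2], intro conjI allI impI)
    show "R2 + G \<le> N" by (rule near_le[OF near]) (use R1u R2 in auto)
    fix n assume n: "R1 < n \<and> n \<le> R1 + G \<or> R2 < n \<and> n \<le> R2 + G"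
    hence "R1 < n" "n \<le> R2 + G" using R1u R2(1) by auto
    note nr = near[OF this]
    have "n \<notin> A'" using n R1(3) R2(3) by blast
    thus "n \<notin> mixed_sums S1 S2 k D" using nr near_le[OF nr] by (auto simp: A'_def A_def)
  next
    fix n i j assume n: "R1 < n \<and> n \<le> R2 + G" "j < D \<and> i \<le> K \<or> j = D \<and> i < k"
    show "n \<notin> mixed_sums S1 S2 i j" using no_T[OF near n(2)] n(1) by blast
  qed (use uA R1u R2(1) in auto)
qed


section \<open>The two exponent sequences\<close>

lemma powr_div_mono:
  fixes s t a b :: real
  assumes "1 \<le> s" "s \<le> t" "1 \<le> a" "a \<le> b"
  shows "s powr a / s \<le> t powr b / t"
proof -
  have "s powr a / s = s powr (a - 1)" using assms by (simp add: powr_diff)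
  also have "\<dots> \<le> t powr (a - 1)" using assms by (intro powr_mono2) auto
  also have "\<dots> \<le> t powr (b - 1)" using assms by (intro powr_mono) auto
  also have "\<dots> = t powr b / t" using assms by (simp add: powr_diff)
  finally show ?thesis .
qed

lemma ln_ge_1: "ln t \<ge> 1" if "t \<ge> exp 1" for t :: real
  using that by (metis exp_gt_zero ln_exp ln_le_cancel_iff order_less_le_trans)

lemma ln_ln_ge_1: "ln (ln t) \<ge> 1" if "t \<ge> exp (exp 1)" for t :: real
proof -
  have "ln t \<ge> exp 1" using that by (metis exp_gt_zero ln_exp ln_le_cancel_iff order_less_le_trans)
  thus ?thesis by (rule ln_ge_1)
qed

lemma exp_exp_1_ge: "exp (exp 1) \<ge> exp (1::real)" "exp (1::real) \<ge> 1"
  by (auto intro: order_trans[of _ "exp 0"])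

interpretation g1: growth "\<lambda>t. t powr ln t" 1 "exp 1"
proof
  fix s t :: real
  show "1 \<le> t powr ln t" if "exp 1 \<le> t"
    using that ln_ge_1[OF that] order.trans[OF exp_exp_1_ge(2) that] by (intro ge_one_powr_ge_zero) auto
  show "s powr ln s / s \<le> t powr ln t / t" if "exp 1 \<le> s" "s \<le> t"
    using that ln_ge_1[OF that(1)] order.trans[OF exp_exp_1_ge(2) that(1)] by (intro powr_div_mono) (auto intro!: ln_mono)
next
  show "filterlim (\<lambda>t::real. t powr ln t) at_top at_top" by real_asymp
  fix p r c :: real
  assume p: "0 < p" "p < r"
  \<comment> \<open>\<open>W (t powr a)\<close> equals \<open>exp (a ^ 2 * ln t ^ 2)\<close>, so in
    the exponent the gain is quadratic in \<open>ln t\<close>, whereas \<open>t powr c\<close>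
    contributes a linear term.\<close>
  define \<delta> where "\<delta> = r ^ 2 - p ^ 2"
  have "\<delta> > 0" using p by (simp add: \<delta>_def power_strict_mono)
  have "eventually (\<lambda>t::real. c * ln t \<le> \<delta> * ln t ^ 2) at_top"
    using \<open>\<delta> > 0\<close> by real_asymp
  moreover have "eventually (\<lambda>t::real. t > 1) at_top" by (rule eventually_gt_at_top)
  ultimately show "eventually (\<lambda>t. (t powr p) powr ln (t powr p) * t powr c \<le> (t powr r) powr ln (t powr r)) at_top"
  proof eventually_elim
    case (elim t)
    have eq: "(t powr a) powr ln (t powr a) = exp (a ^ 2 * ln t ^ 2)" for a
      using elim by (simp add: powr_def ln_powr power2_eq_square algebra_simps)
    have "(t powr p) powr ln (t powr p) * t powr c = exp (p ^ 2 * ln t ^ 2 + c * ln t)"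
      using elim by (subst eq) (simp add: powr_def exp_add)
    also have "\<dots> \<le> exp (r ^ 2 * ln t ^ 2)"
      using elim by (simp add: \<delta>_def algebra_simps)
    finally show ?case by (subst (2) eq)
  qed
qed (auto simp: exp_exp_1_ge)

interpretation g2: growth "\<lambda>t. t powr ln (ln t)" 3 "exp (exp 1)"
proof
  show "1 \<le> exp (exp (1::real))" by auto
  fix s t :: real
  show "1 \<le> t powr ln (ln t)" if "exp (exp 1) \<le> t"
    using that ln_ln_ge_1[OF that] exp_exp_1_ge by (intro ge_one_powr_ge_zero) linarith+
  show "s powr ln (ln s) / s \<le> t powr ln (ln t) / t" if st: "exp (exp 1) \<le> s" "s \<le> t"
  proof (rule powr_div_mono)
    have "exp 1 \<le> s" using st exp_exp_1_ge by linarith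
    hence "ln s \<ge> 1" by (rule ln_ge_1)
    moreover show "1 \<le> s" using st exp_exp_1_ge by linarith
    hence "ln s \<le> ln t" using st by (intro ln_mono) auto
    ultimately show "ln (ln s) \<le> ln (ln t)" using ln_mono[of "ln s" "ln t"] by simp
  qed (use st ln_ln_ge_1 in auto)
next
  show "filterlim (\<lambda>t::real. t powr ln (ln t)) at_top at_top" by real_asymp
  fix p r c :: real
  assume p: "0 < p" "p < r"
  \<comment> \<open>With \<open>y = ln t\<close> the gain \<open>(r - p) * y * ln y\<close> in the
    exponent beats all terms that are linear in \<open>y\<close>.\<close>
  have "eventually (\<lambda>y::real. p * (y * ln (p * y)) + c * y \<le> r * (y * ln (r * y))) at_top"
  proof -
    define \<delta> where "\<delta> = r - p"
    have "\<delta> > 0" using p by (simp add: \<delta>_def)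
    have "eventually (\<lambda>y::real. p * ln p * y + c * y \<le> r * ln r * y + \<delta> * (y * ln y)) at_top"
      using \<open>\<delta> > 0\<close> by real_asymp
    thus ?thesis using eventually_gt_at_top[of 0]
      by eventually_elim (use p in \<open>simp add: \<delta>_def ln_mult algebra_simps\<close>)
  qed
  hence "eventually (\<lambda>t::real. p * (ln t * ln (p * ln t)) + c * ln t \<le> r * (ln t * ln (r * ln t))) at_top"
    by (rule eventually_compose_filterlim) real_asymp
  moreover have "eventually (\<lambda>t::real. t > 1) at_top" by (rule eventually_gt_at_top)
  ultimately show "eventually (\<lambda>t. (t powr p) powr ln (ln (t powr p)) * t powr c
      \<le> (t powr r) powr ln (ln (t powr r))) at_top"
  proof eventually_elim
    case (elim t)
    have eq: "(t powr a) powr ln (ln (t powr a)) = exp (a * (ln t * ln (a * ln t)))" for a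
      using elim by (simp add: powr_def ln_powr mult_ac)
    have "(t powr p) powr ln (ln (t powr p)) * t powr c = exp (p * (ln t * ln (p * ln t)) + c * ln t)"
      using elim by (subst eq) (simp add: powr_def exp_add)
    also have "\<dots> \<le> exp (r * (ln t * ln (r * ln t)))"
      using elim by simp
    finally show ?case by (subst (2) eq)
  qed
qed


text \<open>
  On the scale \<open>N = exp (x\<^sup>2)\<close> the first sequence has about \<open>exp x\<close> elements below \<open>N\<close> and the second about
  \<open>exp (zeta x)\<close>.
\<close>

definition zeta :: "real \<Rightarrow> real" where "zeta x = x ^ 2 / (2 * ln x)"

lemma zeta_at_top: "filterlim zeta at_top at_top"
  unfolding zeta_def by real_asymp

text \<open>\<open>x\<close> is of smaller order than \<open>zeta x\<close>, so a factor
  \<open>exp (A * x)\<close>, hence any power of the count for the first sequence, disappears in an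
  arbitrarily small change of the coefficient of \<open>zeta x\<close>.\<close>

lemma exp_zeta_absorb:
  assumes "a < b"
  shows "eventually (\<lambda>x. C * exp (A * x + a * zeta x) \<le> exp (b * zeta x)) at_top"
proof -
  define \<delta> where "\<delta> = b - a"
  have "\<delta> > 0" using assms by (simp add: \<delta>_def)
  have "eventually (\<lambda>x. ln (\<bar>C\<bar> + 1) + A * x \<le> \<delta> * zeta x) at_top"
    unfolding zeta_def using \<open>\<delta> > 0\<close> by real_asymp
  thus ?thesis
  proof eventually_elim
    case (elim x)
    have "C * exp (A * x + a * zeta x) \<le> (\<bar>C\<bar> + 1) * exp (A * x + a * zeta x)"
      by (intro mult_right_mono) auto
    also have "\<dots> = exp (ln (\<bar>C\<bar> + 1) + A * x + a * zeta x)" by (simp add: exp_add)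
    also have "\<dots> \<le> exp (b * zeta x)" using elim by (simp add: \<delta>_def algebra_simps)
    finally show ?case .
  qed
qed

text \<open>\<open>zeta x\<close> is the leading asymptotic form of the solution \<open>y\<close> of
  \<open>y * ln y = x ^ 2\<close>: its logarithm is \<open>2 * ln x\<close> up to lower order, which
  cancels the denominator.\<close>

lemma zeta_ln_zeta_asymp:
  assumes "a > 0"
  shows "((\<lambda>x. a * zeta x * ln (a * zeta x) / x ^ 2) \<longlongrightarrow> a) at_top"
  unfolding zeta_def using assms by real_asymp

text \<open>The margin \<open>x\<close> is there because the gaps of the first sequence at index
  \<open>exp x\<close> are only about \<open>exp (x ^ 2 - x)\<close>.\<close>

lemma exp_zeta_ln_zeta_le:
  assumes "0 < a" "a < b"
  shows "eventually (\<lambda>x. C * exp (a * zeta x * ln (a * zeta x)) \<le> exp (b * x ^ 2 - x)) at_top"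
proof -
  define m where "m = (a + b) / 2"
  define \<delta> where "\<delta> = b - m"
  have m: "a < m" "\<delta> > 0" using assms by (auto simp: m_def \<delta>_def field_simps)
  have "eventually (\<lambda>x. a * zeta x * ln (a * zeta x) / x ^ 2 < m) at_top"
    by (rule order_tendstoD(2)[OF zeta_ln_zeta_asymp[OF assms(1)] m(1)])
  moreover have "eventually (\<lambda>x. ln (\<bar>C\<bar> + 1) + x \<le> \<delta> * x ^ 2) at_top"
    using m by real_asymp
  moreover have "eventually (\<lambda>x::real. x > 0) at_top" by (rule eventually_gt_at_top)
  ultimately show ?thesis
  proof eventually_elim
    case (elim x)
    have "C * exp (a * zeta x * ln (a * zeta x)) \<le> (\<bar>C\<bar> + 1) * exp (a * zeta x * ln (a * zeta x))"
      by (intro mult_right_mono) auto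
    also have "\<dots> = exp (ln (\<bar>C\<bar> + 1) + a * zeta x * ln (a * zeta x))" by (simp add: exp_add)
    also have "\<dots> \<le> exp (b * x ^ 2 - x)"
      using elim by (simp add: \<delta>_def field_simps)
    finally show ?case .
  qed
qed

lemma exp_zeta_ln_zeta_ge:
  assumes "0 < a" "b < a"
  shows "eventually (\<lambda>x. C * exp (b * x ^ 2) \<le> exp (a * zeta x * ln (a * zeta x))) at_top"
proof -
  define m where "m = (a + b) / 2"
  define \<delta> where "\<delta> = m - b"
  have m: "m < a" "\<delta> > 0" using assms by (auto simp: m_def \<delta>_def field_simps)
  have "eventually (\<lambda>x. a * zeta x * ln (a * zeta x) / x ^ 2 > m) at_top"
    by (rule order_tendstoD(1)[OF zeta_ln_zeta_asymp[OF assms(1)] m(1)])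
  moreover have "eventually (\<lambda>x. ln (\<bar>C\<bar> + 1) \<le> \<delta> * x ^ 2) at_top"
    using m by real_asymp
  moreover have "eventually (\<lambda>x::real. x > 0) at_top" by (rule eventually_gt_at_top)
  ultimately show ?thesis
  proof eventually_elim
    case (elim x)
    have "C * exp (b * x ^ 2) \<le> (\<bar>C\<bar> + 1) * exp (b * x ^ 2)"
      by (intro mult_right_mono) auto
    also have "\<dots> = exp (ln (\<bar>C\<bar> + 1) + b * x ^ 2)" by (simp add: exp_add)
    also have "\<dots> \<le> exp (a * zeta x * ln (a * zeta x))"
      using elim by (simp add: \<delta>_def field_simps)
    finally show ?case .
  qed
qed

lemma growth1_exp: "exp y powr ln (exp y) = exp (y ^ 2)" for y :: real
  by (simp add: powr_def power2_eq_square)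

lemma growth2_exp: "exp y powr ln (ln (exp y)) = exp (y * ln y)" for y :: real
  by (simp add: powr_def mult.commute)


text \<open>The gap is located by value and not by index. A value above the growth function at
  \<open>q\<close> cannot come from an index up to \<open>q\<close>, and from there on the sequence
  is nondecreasing with known gaps.\<close>

lemma g2_gap_beyond:
  assumes "exp (exp 1) \<le> q" "\<forall>n. real n \<le> q \<longrightarrow> real (g2.w n) \<le> q powr ln (ln q)"
    and "\<sigma> \<in> g2.S" "\<sigma>' \<in> g2.S" "\<sigma> < \<sigma>'" "q powr ln (ln q) < real \<sigma>"
  shows "real \<sigma> + (q powr ln (ln q) / q - 1) \<le> real \<sigma>'"
proof -
  obtain n n' where n: "\<sigma> = g2.w n" "\<sigma>' = g2.w n'" using assms(3,4) by (auto simp: g2.S_def)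
  have q: "q \<le> real n" "q \<le> real n'"
    using assms(2,5,6) n by (metis linorder_not_le nle_le of_nat_less_iff order_less_trans)+
  have "n < n'"
  proof (rule ccontr)
    assume "\<not> n < n'"
    hence "n' < n" using assms(5) n by (cases n n' rule: linorder_cases) auto
    hence "real (g2.w n') + (real n' powr ln (ln (real n')) / real n' - 1) \<le> real (g2.w n)"
      using q assms(1) by (intro g2.w_gap) auto
    moreover have "real n' powr ln (ln (real n')) / real n' \<ge> 1"
    proof -
      have "1 \<le> real n' powr (ln (ln (real n')) - 1)"
        using q(2) assms(1) ln_ln_ge_1[of "real n'"] exp_exp_1_ge by (intro ge_one_powr_ge_zero) linarith+
      moreover have "real n' > 0" using q(2) assms(1) exp_exp_1_ge by linarith
      ultimately show ?thesis by (simp add: powr_diff)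
    qed
    ultimately show False using assms(5) n by linarith
  qed
  thus ?thesis unfolding n using q assms(1) by (intro g2.w_gap) auto
qed

lemma isolated_cluster:
  fixes k D K :: nat and B :: real
  assumes kD: "k \<ge> 1" "D \<ge> 1" and B: "B > 0"
  defines "Q \<equiv> mixed_sums g1.S g2.S"
  shows "\<exists>u R1 R2 G. u \<in> Q k D \<and> R1 + G < u \<and> u \<le> R2 \<and>
    B * ln (real (R1 + G + 2)) \<le> real G \<and> B * ln (real (R2 + G + 2)) \<le> real G \<and>
    (\<forall>n i j. R1 < n \<and> n \<le> R2 + G \<longrightarrow> j < D \<and> i \<le> K \<or> j = D \<and> i < k \<longrightarrow> n \<notin> Q i j) \<and>
    (\<forall>n. R1 < n \<and> n \<le> R1 + G \<or> R2 < n \<and> n \<le> R2 + G \<longrightarrow> n \<notin> Q k D)"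
proof -
  \<comment> \<open>With this choice the difference \<open>7 * \<eta> * D\<close> between the
    exponents \<open>(1 + 5 * \<eta>) * D\<close> and \<open>(1 - 2 * \<eta>) * D\<close> of the
    upper and lower counts stays below \<open>2 / 5\<close>, and \<open>3 * \<eta> * (k - 1)\<close>
    stays below 1.\<close>
  define \<eta> :: real where "\<eta> = 1 / (20 * (D + k + 1))"
  have \<eta>0: "0 < \<eta>" "\<eta> \<le> 1 / 60" using kD by (auto simp: \<eta>_def field_simps)
  have \<eta>D: "20 * (\<eta> * D) < 1" "20 * (\<eta> * k) < 1"
    by (auto simp: \<eta>_def field_simps)
  have Dr: "real D \<ge> 1" "real k \<ge> 1" "real (D - 1) = D - 1" "real (k - 1) = k - 1" using kD by auto
  \<comment> \<open>\<open>a1\<close> bounds the sums in \<open>V1\<close>; the levels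
    \<open>a2\<close> (with \<open>x ^ 2\<close>) and \<open>e4\<close> cover all exponents up to
    \<open>N\<close> in the two sequences. \<open>e2\<close> bounds the sums in \<open>V2\<close>,
    and \<open>e3\<close> marks where the gaps of the second sequence exceed those sums. Both stay
    below 1, so that the corresponding values are small against the gaps of the first
    sequence.\<close>
  define a1 where "a1 = (1 + \<eta>) ^ 2"
  define a2 where "a2 = (1 + 2 * \<eta>) ^ 2"
  define e2 where "e2 = (1 - 2 * \<eta>) * (1 + \<eta>)"
  define e3 where "e3 = 1 - \<eta> / 2"
  define e4 where "e4 = 1 + 4 * \<eta>"
  \<comment> \<open>\<open>W e x\<close> is the second growth function at
    \<open>exp (e * zeta x)\<close>.\<close>
  define W where "W = (\<lambda>e x. exp (e * zeta x * ln (e * zeta x)))"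
  have \<eta>sq: "\<eta> ^ 2 < \<eta>" "\<eta> ^ 2 > 0" using \<eta>0 by (auto simp: power2_eq_square)
  have coeff: "1 < a1" "a1 < a2" "a1 < e4" "0 < e2" "e2 < e3" "e3 < 1"
    using \<eta>0 \<eta>sq by (auto simp: a1_def a2_def e2_def e3_def e4_def power2_eq_square algebra_simps intro!: mult_pos_pos)
  have V1: "eventually (\<lambda>x. \<exists>V. finite V \<and> V \<subseteq> nsum g1.S k \<and> (\<forall>v\<in>V. real v \<le> exp (a1 * x ^ 2)) \<and>
      exp x ^ k \<le> real (card V) \<and> separated (exp (x ^ 2 - x)) V) at_top"
  proof -
    have "exp x powr (1 + \<eta>) = exp ((1 + \<eta>) * x)" for x :: real by (simp add: powr_def)
    hence 1: "(exp x powr (1 + \<eta>)) powr ln (exp x powr (1 + \<eta>)) = exp (a1 * x ^ 2)" for x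
      by (simp only: growth1_exp) (simp add: a1_def power_mult_distrib)
    have 2: "exp x powr ln (exp x) / exp x = exp (x ^ 2 - x)" for x :: real
      unfolding growth1_exp by (simp add: exp_diff)
    show ?thesis
      using eventually_compose_filterlim[OF g1.separated_sums[OF \<eta>0(1), of k] exp_at_top] unfolding 1 2 .
  qed
  have V2: "eventually (\<lambda>x. \<exists>V. finite V \<and> V \<subseteq> nsum g2.S D \<and> (\<forall>v\<in>V. real v \<le> W e2 x) \<and>
      exp ((1 - 2 * \<eta>) * D * zeta x) \<le> real (card V) \<and> separated (W (1 - 2 * \<eta>) x / exp ((1 - 2 * \<eta>) * zeta x)) V) at_top"
  proof -
    have lim: "filterlim (\<lambda>x. exp ((1 - 2 * \<eta>) * zeta x)) at_top at_top"
      using \<eta>0 by (intro filterlim_compose[OF exp_at_top] filterlim_tendsto_pos_mult_at_top[OF tendsto_const] zeta_at_top) auto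
    have "exp ((1 - 2 * \<eta>) * zeta x) powr (1 + \<eta>) = exp (e2 * zeta x)" for x
      by (simp add: powr_def e2_def algebra_simps)
    hence 1: "(exp ((1 - 2 * \<eta>) * zeta x) powr (1 + \<eta>)) powr ln (ln (exp ((1 - 2 * \<eta>) * zeta x) powr (1 + \<eta>))) = W e2 x" for x
      by (simp only: growth2_exp W_def)
    have 2: "exp ((1 - 2 * \<eta>) * zeta x) powr ln (ln (exp ((1 - 2 * \<eta>) * zeta x))) = W (1 - 2 * \<eta>) x" for x
      by (simp only: growth2_exp W_def)
    have 3: "exp ((1 - 2 * \<eta>) * zeta x) ^ D = exp ((1 - 2 * \<eta>) * D * zeta x)" for x
      by (simp flip: exp_of_nat_mult add: mult_ac)
    show ?thesis
      using eventually_compose_filterlim[OF g2.separated_sums[OF \<eta>0(1), of D] lim] unfolding 1 2 3 .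
  qed
  have q1: "eventually (\<lambda>x. 2 * exp (a1 * x ^ 2) + 2 \<le> exp (a2 * x ^ 2)) at_top"
  proof -
    have "0 < a1" using coeff by linarith
    define \<delta> where "\<delta> = a2 - a1"
    have "\<delta> > 0" using coeff by (simp add: \<delta>_def)
    have "eventually (\<lambda>x::real. 4 \<le> exp (\<delta> * x ^ 2)) at_top" using \<open>\<delta> > 0\<close> by real_asymp
    thus ?thesis
    proof eventually_elim
      case (elim x)
      have "1 \<le> exp (a1 * x ^ 2)" using \<open>0 < a1\<close> by simp
      hence "2 * exp (a1 * x ^ 2) + 2 \<le> exp (a1 * x ^ 2) * 4" by linarith
      also have "\<dots> \<le> exp (a1 * x ^ 2) * exp (\<delta> * x ^ 2)" using elim by simp
      also have "\<dots> = exp (a2 * x ^ 2)" by (simp add: \<delta>_def algebra_simps flip: exp_add)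
      finally show ?case .
    qed
  qed
  have q2: "eventually (\<lambda>x. 4 * exp (a1 * x ^ 2) \<le> W e4 x) at_top"
    unfolding W_def using coeff by (intro exp_zeta_ln_zeta_ge) auto
  have M: "eventually (\<lambda>x. 16 * W e2 x \<le> exp (x ^ 2 - x)) at_top"
    using exp_zeta_ln_zeta_le[of e2 1 16] coeff unfolding W_def by simp
  have q3: "eventually (\<lambda>x. 16 * D * W e3 x \<le> exp (x ^ 2 - x)) at_top"
    using exp_zeta_ln_zeta_le[of e3 1 "16 * D"] coeff unfolding W_def by simp
  have L: "eventually (\<lambda>x. 16 * exp (zeta x / 2) \<le> exp (x ^ 2 - x) / 4) at_top"
    unfolding zeta_def by real_asymp
  have H: "eventually (\<lambda>x::real. exp (x ^ 2 - x) + 1 \<le> exp (x ^ 2)) at_top" by real_asymp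
  have z: "eventually (\<lambda>x. 2 * exp 1 \<le> zeta x) at_top"
    using zeta_at_top by (simp add: filterlim_at_top)
  \<comment> \<open>Of the exponent \<open>e3 + 1\<close>, the part \<open>e3\<close> is lost in
    dividing \<open>W e3 x\<close> by the index \<open>exp (e3 * zeta x)\<close>; what remains is a
    gap larger than \<open>W e2 x\<close> by a factor \<open>exp (zeta x)\<close>.\<close>
  have spr: "eventually (\<lambda>x. W e2 x * exp ((e3 + 1) * zeta x) \<le> W e3 x) at_top"
  proof -
    have lim: "filterlim (\<lambda>x. exp (zeta x)) at_top at_top"
      by (intro filterlim_compose[OF exp_at_top] zeta_at_top)
    have 1: "exp (zeta x) powr e = exp (e * zeta x)" for x e by (simp add: powr_def)
    show ?thesis
      using eventually_compose_filterlim[OF g2.spread[OF coeff(4,5), of "e3 + 1"] lim]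
      unfolding 1 growth2_exp W_def .
  qed
  have gap2: "eventually (\<lambda>x. 2 * exp (zeta x / 2) < W (1 - 2 * \<eta>) x / exp ((1 - 2 * \<eta>) * zeta x)) at_top"
  proof -
    define e where "e = 1 - 2 * \<eta>"
    have "e > 0" using \<eta>0 by (simp add: e_def)
    hence "eventually (\<lambda>z::real. 2 * exp (z / 2) < exp (e * z * ln (e * z)) / exp (e * z)) at_top"
      by real_asymp
    from eventually_compose_filterlim[OF this zeta_at_top] show ?thesis by (simp add: W_def e_def)
  qed
  \<comment> \<open>In powers of \<open>exp x\<close>, the shorter sums have exponent
    \<open>(1 + 3 * \<eta>) * (k - 1)\<close> and the sums in \<open>V1\<close> have exponent
    \<open>k\<close>, which is larger for small \<open>\<eta>\<close>.\<close>
  have P1: "eventually (\<lambda>x. real k * exp ((1 + 3 * \<eta>) * x) ^ (k - 1) < exp x ^ k) at_top"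
  proof -
    define \<delta> where "\<delta> = k - (1 + 3 * \<eta>) * real (k - 1)"
    have "\<delta> > 0" using \<eta>0 \<eta>D Dr by (simp add: \<delta>_def algebra_simps)
    hence "eventually (\<lambda>x. real k < exp (\<delta> * x)) at_top" by real_asymp
    thus ?thesis
    proof eventually_elim
      case (elim x)
      have "real k * exp ((1 + 3 * \<eta>) * x) ^ (k - 1) < exp (\<delta> * x) * exp ((1 + 3 * \<eta>) * x) ^ (k - 1)"
        using elim by simp
      also have "\<dots> = exp x ^ k" by (simp add: \<delta>_def algebra_simps flip: exp_of_nat_mult exp_add)
      finally show ?case .
    qed
  qed
  have l1: "eventually (\<lambda>x. exp ((1 + 2 * \<eta>) * x) + 1 \<le> exp ((1 + 3 * \<eta>) * x)) at_top"
    using \<eta>0 by real_asymp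
  have l2: "eventually (\<lambda>x. exp (e4 * zeta x) + 1 \<le> exp ((1 + 5 * \<eta>) * zeta x)) at_top"
  proof -
    have "eventually (\<lambda>x. exp (e4 * x) + 1 \<le> exp ((1 + 5 * \<eta>) * x)) at_top"
      using \<eta>0 unfolding e4_def by real_asymp
    from eventually_compose_filterlim[OF this zeta_at_top] show ?thesis by simp
  qed
  have c1: "eventually (\<lambda>x. (4 * (K + 1) * D) * exp ((1 + 3 * \<eta>) * K * x + (1 + 5 * \<eta>) * (D - 1) * zeta x)
      \<le> exp ((1 - 2 * \<eta>) * D * zeta x)) at_top"
    by (intro exp_zeta_absorb) (use \<eta>0 \<eta>D Dr in \<open>simp add: algebra_simps\<close>)
  have c2: "eventually (\<lambda>x. (4 * k) * exp ((1 + 3 * \<eta>) * (k - 1) * x + (1 + 5 * \<eta>) * (D - 1) * zeta x)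
      \<le> exp ((1 - 2 * \<eta>) * D * zeta x)) at_top"
    by (intro exp_zeta_absorb) (use \<eta>0 \<eta>D Dr in \<open>simp add: algebra_simps\<close>)
  have c3: "eventually (\<lambda>x. 4 * exp ((1 + 3 * \<eta>) * k * x + ((1 + 5 * \<eta>) * D - 2 / 5) * zeta x)
      \<le> exp ((1 - 2 * \<eta>) * D * zeta x)) at_top"
    by (intro exp_zeta_absorb) (use \<eta>0 \<eta>D Dr in \<open>simp add: algebra_simps\<close>)
  \<comment> \<open>There are at most \<open>exp (2 / 5 * zeta x)\<close> points in the window and
    the gap has length at most \<open>exp (zeta x / 20)\<close>. The total exponent
    \<open>9 / 20\<close> is below the \<open>1 / 2\<close> of the window.\<close>
  have G1: "eventually (\<lambda>x. (exp (2 / 5 * zeta x) + 1) * exp (zeta x / 20) + 1 \<le> exp (zeta x / 2)) at_top"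
  proof -
    have "eventually (\<lambda>x::real. (exp (2 / 5 * x) + 1) * exp (x / 20) + 1 \<le> exp (x / 2)) at_top" by real_asymp
    from eventually_compose_filterlim[OF this zeta_at_top] show ?thesis by simp
  qed
  \<comment> \<open>The required gap is logarithmic in \<open>N\<close>, hence of order
    \<open>x ^ 2\<close>; the subtracted 1 accounts for the floor in \<open>G\<close>.\<close>
  have G2: "eventually (\<lambda>x. B * (a1 * x ^ 2 + ln 4) \<le> exp (zeta x / 20) - 1) at_top"
    unfolding zeta_def using B coeff(1) by real_asymp
  have far: "eventually (\<lambda>x. \<forall>n. real n \<le> exp (e3 * zeta x) \<longrightarrow> real (g2.w n) \<le> W e3 x) at_top"
  proof -
    have lim: "filterlim (\<lambda>x. exp (e3 * zeta x)) at_top at_top"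
      using coeff by (intro filterlim_compose[OF exp_at_top] filterlim_tendsto_pos_mult_at_top[OF tendsto_const] zeta_at_top) auto
    show ?thesis
      using eventually_compose_filterlim[OF g2.eventually_w_le_W lim] unfolding growth2_exp W_def .
  qed
  have x1: "eventually (\<lambda>x::real. x \<ge> 1) at_top" by (rule eventually_ge_at_top)
  have z2: "eventually (\<lambda>x. 2 * exp (zeta x / 2) + 2 < exp (zeta x)) at_top"
  proof -
    have "eventually (\<lambda>x::real. 2 * exp (x / 2) + 2 < exp x) at_top" by real_asymp
    from eventually_compose_filterlim[OF this zeta_at_top] show ?thesis by simp
  qed
  from V1 V2 q1 q2 M q3 L H z spr gap2 P1 l1 l2 c1 c2 c3 G1 G2 far x1 z2
  have "eventually (\<lambda>x::real. \<exists>u R1 R2 G. u \<in> Q k D \<and> R1 + G < u \<and> u \<le> R2 \<and>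
    B * ln (real (R1 + G + 2)) \<le> real G \<and> B * ln (real (R2 + G + 2)) \<le> real G \<and>
    (\<forall>n i j. R1 < n \<and> n \<le> R2 + G \<longrightarrow> j < D \<and> i \<le> K \<or> j = D \<and> i < k \<longrightarrow> n \<notin> Q i j) \<and>
    (\<forall>n. R1 < n \<and> n \<le> R1 + G \<or> R2 < n \<and> n \<le> R2 + G \<longrightarrow> n \<notin> Q k D)) at_top"
  proof eventually_elim
    case (elim x)
    note V1 = elim(1) and V2 = elim(2) and q1 = elim(3) and q2 = elim(4) and M = elim(5) and q3 = elim(6)
      and L = elim(7) and H = elim(8) and z = elim(9) and spr = elim(10) and gap2 = elim(11) and P1 = elim(12)
      and l1 = elim(13) and l2 = elim(14) and c1 = elim(15) and c2 = elim(16) and c3 = elim(17)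
      and G1 = elim(18) and G2 = elim(19) and far = elim(20) and x1 = elim(21) and z2 = elim(22)
    obtain V1 where V1: "finite V1" "V1 \<subseteq> nsum g1.S k" "\<And>v. v \<in> V1 \<Longrightarrow> real v \<le> exp (a1 * x ^ 2)"
      "exp x ^ k \<le> real (card V1)" "separated (exp (x ^ 2 - x)) V1" using V1 by blast
    obtain V2 where V2: "finite V2" "V2 \<subseteq> nsum g2.S D" "\<And>v. v \<in> V2 \<Longrightarrow> real v \<le> W e2 x"
      "exp ((1 - 2 * \<eta>) * D * zeta x) \<le> real (card V2)"
      "separated (W (1 - 2 * \<eta>) x / exp ((1 - 2 * \<eta>) * zeta x)) V2" using V2 by blast
    \<comment> \<open>The factor 2 leaves room above the largest \<open>v\<close> for the distance
      \<open>Hx\<close> and for the sums in \<open>V2\<close>.\<close>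
    define N where "N = nat \<lfloor>2 * exp (a1 * x ^ 2)\<rfloor>"
    have N: "real N \<le> 2 * exp (a1 * x ^ 2)" "2 * exp (a1 * x ^ 2) < real N + 1"
      unfolding N_def by (simp_all add: of_nat_floor)
    define G where "G = nat \<lfloor>exp (zeta x / 20)\<rfloor>"
    have G: "real G \<le> exp (zeta x / 20)" "exp (zeta x / 20) < real G + 1"
      unfolding G_def by (simp_all add: of_nat_floor)
    have ea1: "exp (x ^ 2) \<le> exp (a1 * x ^ 2)" "1 \<le> exp (a1 * x ^ 2)"
      using coeff(1) mult_right_mono[of 1 a1 "x ^ 2"] by simp_all
    have Wpos: "W e x > 0" for e by (simp add: W_def)
    have zpos: "zeta x > 0" using z by (rule less_le_trans[rotated]) simp
    define Hx where "Hx = exp (x ^ 2 - x) / 4"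
    define Lx where "Lx = exp (zeta x / 2)"
    have Lx: "1 \<le> Lx" using zpos by (simp add: Lx_def)
    have HL: "16 * Lx \<le> Hx" "4 * W e2 x \<le> Hx" "4 * D * W e3 x \<le> Hx" "4 * Hx + 1 \<le> exp (x ^ 2)"
      using L M q3 H by (simp_all add: Lx_def Hx_def)
    define \<kappa>1 where "\<kappa>1 = exp ((1 + 3 * \<eta>) * x)"
    define \<kappa>2 where "\<kappa>2 = exp ((1 + 5 * \<eta>) * zeta x)"
    have \<kappa>: "1 \<le> \<kappa>1" "1 \<le> \<kappa>2" using x1 zpos \<eta>0 by (simp_all add: \<kappa>1_def \<kappa>2_def)
    have S1: "finite (g1.S \<inter> {..N})" "real (card (g1.S \<inter> {..N})) \<le> \<kappa>1"
    proof -
      have "1 * x \<le> (1 + 2 * \<eta>) * x" using \<eta>0 x1 by (intro mult_right_mono) auto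
      hence "1 \<le> (1 + 2 * \<eta>) * x" using x1 by linarith
      hence "exp 1 \<le> exp ((1 + 2 * \<eta>) * x)" by simp
      moreover have "real N + 1 \<le> exp ((1 + 2 * \<eta>) * x) powr ln (exp ((1 + 2 * \<eta>) * x))"
        unfolding growth1_exp using q1 N(1) by (simp add: a2_def power_mult_distrib)
      ultimately have "finite (g1.S \<inter> {..N}) \<and> real (card (g1.S \<inter> {..N})) \<le> exp ((1 + 2 * \<eta>) * x) + 1"
        by (rule g1.card_S_le)
      thus "finite (g1.S \<inter> {..N})" "real (card (g1.S \<inter> {..N})) \<le> \<kappa>1" using l1 by (auto simp: \<kappa>1_def)
    qed
    have big_exp: "exp (exp 1) \<le> exp (e * zeta x)" if "e \<ge> 1 / 2" for e
    proof -
      have "exp 1 \<le> e * zeta x"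
        using z that mult_mono[of "1/2" e "2 * exp 1" "zeta x"] by simp
      thus ?thesis by simp
    qed
    have S2: "finite (g2.S \<inter> {..N})" "real (card (g2.S \<inter> {..N})) \<le> \<kappa>2"
    proof -
      have "exp (exp 1) \<le> exp (e4 * zeta x)" using \<eta>0 by (intro big_exp) (simp add: e4_def)
      moreover have "real N + 1 \<le> exp (e4 * zeta x) powr ln (ln (exp (e4 * zeta x)))"
        unfolding growth2_exp using q2 N(1) ea1(2) unfolding W_def by linarith
      ultimately have "finite (g2.S \<inter> {..N}) \<and> real (card (g2.S \<inter> {..N})) \<le> exp (e4 * zeta x) + 1"
        by (rule g2.card_S_le)
      thus "finite (g2.S \<inter> {..N})" "real (card (g2.S \<inter> {..N})) \<le> \<kappa>2" using l2 by (auto simp: \<kappa>2_def)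
    qed
    have big: "real \<sigma> + W e2 x + 2 * Lx < real \<sigma>'"
      if \<sigma>: "\<sigma> \<in> g2.S" "\<sigma>' \<in> g2.S" "\<sigma> < \<sigma>'" "Hx - Lx \<le> D * real \<sigma>" for \<sigma> \<sigma>'
    proof -
      have W3: "exp (e3 * zeta x) powr ln (ln (exp (e3 * zeta x))) = W e3 x" unfolding growth2_exp W_def ..
      have "D * W e3 x < D * real \<sigma>" using HL(1,3) \<sigma>(4) Lx Wpos by linarith
      hence "W e3 x < real \<sigma>" using kD(2) by simp
      hence le: "real \<sigma> + (W e3 x / exp (e3 * zeta x) - 1) \<le> real \<sigma>'"
        using g2_gap_beyond[of "exp (e3 * zeta x)" \<sigma> \<sigma>', unfolded W3] \<sigma> far big_exp[of e3] \<eta>0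
        by (simp add: e3_def)
      have "W e2 x * exp (zeta x) \<le> W e3 x / exp (e3 * zeta x)"
        using spr by (simp add: field_simps exp_add)
      moreover have "1 \<le> W e2 x"
      proof -
        have "e2 \<ge> 1 / 2" using \<eta>0 \<eta>sq by (simp add: e2_def power2_eq_square algebra_simps)
        hence "exp 1 \<le> e2 * zeta x" using big_exp[of e2] by simp
        hence "1 \<le> e2 * zeta x" using exp_exp_1_ge(2) by linarith
        thus ?thesis by (simp add: W_def)
      qed
      hence "1 * (exp (zeta x) - 1) \<le> W e2 x * (exp (zeta x) - 1)"
        using zpos by (intro mult_right_mono) auto
      hence "W e2 x + exp (zeta x) - 1 \<le> W e2 x * exp (zeta x)" by (simp add: algebra_simps)
      ultimately show ?thesis using le z2 by (simp add: Lx_def)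
    qed
    have card: "(K + 1) * D * \<kappa>1 ^ K * \<kappa>2 ^ (D - 1) + k * \<kappa>1 ^ (k - 1) * \<kappa>2 ^ (D - 1)
        + \<kappa>1 ^ k * \<kappa>2 ^ D / exp (2 / 5 * zeta x) < card V2"
    proof -
      define E where "E = exp ((1 - 2 * \<eta>) * D * zeta x)"
      have "\<kappa>1 ^ K * \<kappa>2 ^ (D - 1) = exp ((1 + 3 * \<eta>) * K * x + (1 + 5 * \<eta>) * (D - 1) * zeta x)"
        unfolding \<kappa>1_def \<kappa>2_def using Dr(3) by (simp add: mult_ac exp_add flip: exp_of_nat_mult)
      hence "real (4 * (K + 1) * D) * (\<kappa>1 ^ K * \<kappa>2 ^ (D - 1)) \<le> E"
        using c1 by (simp only: E_def)
      hence 1: "4 * ((K + 1) * D * \<kappa>1 ^ K * \<kappa>2 ^ (D - 1)) \<le> E"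
        by (simp add: algebra_simps)
      have "\<kappa>1 ^ (k - 1) * \<kappa>2 ^ (D - 1) = exp ((1 + 3 * \<eta>) * (k - 1) * x + (1 + 5 * \<eta>) * (D - 1) * zeta x)"
        unfolding \<kappa>1_def \<kappa>2_def using Dr(3,4) by (simp add: mult_ac exp_add flip: exp_of_nat_mult)
      hence "real (4 * k) * (\<kappa>1 ^ (k - 1) * \<kappa>2 ^ (D - 1)) \<le> E"
        using c2 by (simp only: E_def)
      hence 2: "4 * (k * \<kappa>1 ^ (k - 1) * \<kappa>2 ^ (D - 1)) \<le> E"
        by (simp add: algebra_simps)
      have "\<kappa>1 ^ k * \<kappa>2 ^ D / exp (2 / 5 * zeta x) = exp ((1 + 3 * \<eta>) * k * x + ((1 + 5 * \<eta>) * D - 2 / 5) * zeta x)"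
        unfolding \<kappa>1_def \<kappa>2_def by (simp add: algebra_simps exp_add exp_diff flip: exp_of_nat_mult)
      hence 3: "4 * (\<kappa>1 ^ k * \<kappa>2 ^ D / exp (2 / 5 * zeta x)) \<le> E"
        using c3 by (simp add: E_def)
      have "E > 0" by (simp add: E_def)
      with 1 2 3 V2(4) show ?thesis unfolding E_def [symmetric] by linarith
    qed
    have "\<exists>u R1 R2. u \<in> mixed_sums g1.S g2.S k D \<and> R1 + G < u \<and> u \<le> R2 \<and> R2 + G \<le> N \<and>
      (\<forall>n i j. R1 < n \<and> n \<le> R2 + G \<longrightarrow> j < D \<and> i \<le> K \<or> j = D \<and> i < k \<longrightarrow> n \<notin> mixed_sums g1.S g2.S i j) \<and>
      (\<forall>n. R1 < n \<and> n \<le> R1 + G \<or> R2 < n \<and> n \<le> R2 + G \<longrightarrow> n \<notin> mixed_sums g1.S g2.S k D)"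
    proof (rule isolated_cluster_from_counts[OF kD S1 \<kappa>(1) S2 \<kappa>(2) V1(2,3) _ V1(5) _ V2(1-3,5) _ big])
      show "k * \<kappa>1 ^ (k - 1) < card V1" using P1 V1(4) unfolding \<kappa>1_def by linarith
      show "2 * Hx < exp (x ^ 2 - x)" by (simp add: Hx_def)
      show "2 * Lx < W (1 - 2 * \<eta>) x / exp ((1 - 2 * \<eta>) * zeta x)" using gap2 by (simp add: Lx_def)
      show "exp (a1 * x ^ 2) + Hx \<le> N" "exp (a1 * x ^ 2) + W e2 x + Lx \<le> N" "W e2 x + Lx \<le> Hx" "0 \<le> W e2 x"
        using HL Lx N ea1 Wpos[of e2] by linarith+
      show "(K + 1) * D * \<kappa>1 ^ K * \<kappa>2 ^ (D - 1) + k * \<kappa>1 ^ (k - 1) * \<kappa>2 ^ (D - 1)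
        + \<kappa>1 ^ k * \<kappa>2 ^ D / exp (2 / 5 * zeta x) < card V2" by (rule card)
      show "exp (2 / 5 * zeta x) > 0" by simp
      have "(exp (2 / 5 * zeta x) + 1) * real G \<le> (exp (2 / 5 * zeta x) + 1) * exp (zeta x / 20)"
        using G(1) by (intro mult_left_mono add_nonneg_nonneg) auto
      thus "(exp (2 / 5 * zeta x) + 1) * real G + 1 \<le> Lx" using G1 unfolding Lx_def by linarith
    qed
    then obtain u R1 R2 where u: "u \<in> Q k D" "R1 + G < u" "u \<le> R2" "R2 + G \<le> N"
      "\<forall>n i j. R1 < n \<and> n \<le> R2 + G \<longrightarrow> j < D \<and> i \<le> K \<or> j = D \<and> i < k \<longrightarrow> n \<notin> Q i j"
      "\<forall>n. R1 < n \<and> n \<le> R1 + G \<or> R2 < n \<and> n \<le> R2 + G \<longrightarrow> n \<notin> Q k D"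
      unfolding Q_def by blast
    have lnG: "B * ln (real (R + G + 2)) \<le> real G" if "R + G \<le> N" for R
    proof -
      have "real (R + G + 2) \<le> real N + 2" using that by linarith
      also have "\<dots> \<le> exp (a1 * x ^ 2) * 4" using N(1) ea1(2) by linarith
      also have "\<dots> = exp (a1 * x ^ 2 + ln 4)" by (simp add: exp_add)
      finally have "ln (real (R + G + 2)) \<le> ln (exp (a1 * x ^ 2 + ln 4))" by (intro ln_mono) auto
      hence "B * ln (real (R + G + 2)) \<le> B * (a1 * x ^ 2 + ln 4)" using B by simp
      also have "\<dots> \<le> exp (zeta x / 20) - 1" by (rule G2)
      also have "\<dots> \<le> real G" using G(2) by simp
      finally show ?thesis .
    qed
    have "R1 + G \<le> N" using u by linarith
    with u lnG show ?case by blast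
  qed
  thus ?thesis by (subst (asm) eventually_const) auto
qed


section \<open>Power series with polynomially bounded coefficients\<close>

text \<open>This class contains the series used here, is closed under sums and products, and
  provides both convergence inside the unit interval and the growth bound that the estimate at the
  conjugates requires.\<close>

definition poly_bounded :: "real fps \<Rightarrow> bool" where
  "poly_bounded F \<longleftrightarrow> (\<exists>C e. C \<ge> 0 \<and> (\<forall>n. \<bar>fps_nth F n\<bar> \<le> C * real (n + 1) ^ e))"

lemma poly_bounded_const: "poly_bounded (fps_const c)"
  unfolding poly_bounded_def by (intro exI[of _ "\<bar>c\<bar>"] exI[of _ 0]) auto

lemma poly_bounded_add:
  assumes "poly_bounded F" "poly_bounded G"
  shows "poly_bounded (F + G)"
proof -
  obtain C e C' e' where *: "C \<ge> 0" "\<And>n. \<bar>fps_nth F n\<bar> \<le> C * real (n + 1) ^ e"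
    "C' \<ge> 0" "\<And>n. \<bar>fps_nth G n\<bar> \<le> C' * real (n + 1) ^ e'"
    using assms unfolding poly_bounded_def by blast
  show ?thesis unfolding poly_bounded_def
  proof (intro exI[of _ "C + C'"] exI[of _ "e + e'"] conjI allI)
    fix n
    have "C * real (n + 1) ^ e \<le> C * real (n + 1) ^ (e + e')"
      "C' * real (n + 1) ^ e' \<le> C' * real (n + 1) ^ (e + e')"
      using * by (intro mult_left_mono power_increasing; simp)+
    thus "\<bar>fps_nth (F + G) n\<bar> \<le> (C + C') * real (n + 1) ^ (e + e')"
      using *(2,4)[of n] by (simp add: distrib_right)
  qed (use * in auto)
qed

lemma poly_bounded_mult:
  assumes "poly_bounded F" "poly_bounded G"
  shows "poly_bounded (F * G)"
proof -
  obtain C e C' e' where *: "C \<ge> 0" "\<And>n. \<bar>fps_nth F n\<bar> \<le> C * real (n + 1) ^ e"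
    "C' \<ge> 0" "\<And>n. \<bar>fps_nth G n\<bar> \<le> C' * real (n + 1) ^ e'"
    using assms unfolding poly_bounded_def by blast
  show ?thesis unfolding poly_bounded_def
  proof (intro exI[of _ "C * C'"] exI[of _ "e + e' + 1"] conjI allI)
    fix n
    have "\<bar>fps_nth (F * G) n\<bar> \<le> (\<Sum>i=0..n. \<bar>fps_nth F i * fps_nth G (n - i)\<bar>)"
      unfolding fps_mult_nth by (rule sum_abs)
    also have "\<dots> \<le> (\<Sum>i=0..n. (C * real (n + 1) ^ e) * (C' * real (n + 1) ^ e'))"
    proof (rule sum_mono)
      fix i assume i: "i \<in> {0..n}"
      have "C * real (i + 1) ^ e \<le> C * real (n + 1) ^ e"
        "C' * real (n - i + 1) ^ e' \<le> C' * real (n + 1) ^ e'"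
        using * i by (intro mult_left_mono power_mono; simp)+
      hence "\<bar>fps_nth F i\<bar> \<le> C * real (n + 1) ^ e" "\<bar>fps_nth G (n - i)\<bar> \<le> C' * real (n + 1) ^ e'"
        using *(2)[of i] *(4)[of "n - i"] by linarith+
      thus "\<bar>fps_nth F i * fps_nth G (n - i)\<bar> \<le> (C * real (n + 1) ^ e) * (C' * real (n + 1) ^ e')"
        unfolding abs_mult using * by (intro mult_mono) auto
    qed
    also have "\<dots> = C * C' * real (n + 1) ^ (e + e' + 1)" by (simp add: power_add algebra_simps)
    finally show "\<bar>fps_nth (F * G) n\<bar> \<le> C * C' * real (n + 1) ^ (e + e' + 1)" .
  qed (use * in auto)
qed

lemma poly_bounded_power: "poly_bounded F \<Longrightarrow> poly_bounded (F ^ k)"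
  by (induction k) (auto intro: poly_bounded_mult poly_bounded_const[of 1, simplified])

lemma poly_bounded_sum: "(\<And>i. i \<in> I \<Longrightarrow> poly_bounded (F i)) \<Longrightarrow> poly_bounded (sum F I)"
  by (induction I rule: infinite_finite_induct)
     (auto intro: poly_bounded_add poly_bounded_const[of 0, simplified])

text \<open>Convergence at some \<open>q\<close> strictly between \<open>b\<close> and 1 makes the
  inequality strict.\<close>

lemma poly_bounded_conv_radius:
  fixes b :: real
  assumes "poly_bounded F" "0 < b" "b < 1"
  shows "norm b < fps_conv_radius F"
proof -
  obtain C e where *: "C \<ge> 0" "\<And>n. \<bar>fps_nth F n\<bar> \<le> C * real (n + 1) ^ e"
    using assms(1) unfolding poly_bounded_def by blast
  define q where "q = (1 + b) / 2"
  have q: "b < q" "0 < q" "q < 1" using assms by (auto simp: q_def)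
  have "summable (\<lambda>n. C * (real (n + 1) ^ e * q ^ n))"
    by (intro summable_mult poly_growth_tail_bound(1)[OF q(2,3) *])
  hence "summable (\<lambda>n. fps_nth F n * q ^ n)"
    by (rule summable_comparison_test')
       (use * q in \<open>simp add: abs_mult mult_right_mono flip: mult.assoc\<close>)
  hence "ereal (norm q) \<le> fps_conv_radius F"
    unfolding fps_conv_radius_def by (rule conv_radius_geI)
  moreover have "ereal (norm b) < ereal (norm q)" using q assms by simp
  ultimately show ?thesis by (rule less_le_trans[rotated])
qed

lemma eval_fps_sum_poly_bounded:
  assumes "\<And>i. i \<in> I \<Longrightarrow> poly_bounded (F i)" "0 < b" "b < 1"
  shows "eval_fps (sum F I) b = (\<Sum>i\<in>I. eval_fps (F i) b)"
  using assms(1)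
proof (induction I rule: infinite_finite_induct)
  case (insert i I)
  hence "poly_bounded (F i)" "poly_bounded (sum F I)" by (auto intro: poly_bounded_sum)
  hence "eval_fps (F i + sum F I) b = eval_fps (F i) b + eval_fps (sum F I) b"
    using assms(2,3) by (intro eval_fps_add poly_bounded_conv_radius)
  thus ?case using insert by simp
qed auto

text \<open>Nonnegativity rules out cancellation, so that the support of a product is exactly the
  sumset of the supports.\<close>

definition has_support :: "real fps \<Rightarrow> nat set \<Rightarrow> bool" where
  "has_support F A \<longleftrightarrow> (\<forall>n. fps_nth F n \<ge> 0 \<and> (fps_nth F n > 0 \<longleftrightarrow> n \<in> A))"

lemma has_support_nth_eq_0: "has_support F A \<Longrightarrow> n \<notin> A \<Longrightarrow> fps_nth F n = 0"
  unfolding has_support_def by (metis order_le_less)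

lemma has_support_mult:
  assumes "has_support F A" "has_support G B"
  shows "has_support (F * G) ((\<lambda>(a, b). a + b) ` (A \<times> B))"
  unfolding has_support_def
proof (intro allI conjI)
  fix n
  have nonneg: "\<And>i. fps_nth F i * fps_nth G (n - i) \<ge> 0"
    using assms by (simp add: has_support_def)
  thus "fps_nth (F * G) n \<ge> 0" by (simp add: fps_mult_nth sum_nonneg)
  have "fps_nth (F * G) n > 0 \<longleftrightarrow> (\<exists>i\<in>{0..n}. fps_nth F i * fps_nth G (n - i) > 0)"
    unfolding fps_mult_nth
  proof
    assume pos: "(\<Sum>i=0..n. fps_nth F i * fps_nth G (n - i)) > 0"
    show "\<exists>i\<in>{0..n}. fps_nth F i * fps_nth G (n - i) > 0"
    proof (rule ccontr)
      assume "\<not> ?thesis"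
      hence "(\<Sum>i=0..n. fps_nth F i * fps_nth G (n - i)) \<le> 0" by (intro sum_nonpos) (auto simp: not_less)
      with pos show False by simp
    qed
  next
    assume "\<exists>i\<in>{0..n}. fps_nth F i * fps_nth G (n - i) > 0"
    then obtain i where "i \<in> {0..n}" "fps_nth F i * fps_nth G (n - i) > 0" by blast
    thus "(\<Sum>i=0..n. fps_nth F i * fps_nth G (n - i)) > 0"
      using nonneg by (intro sum_pos2[of _ i]) auto
  qed
  also have "\<dots> \<longleftrightarrow> (\<exists>i\<in>{0..n}. i \<in> A \<and> n - i \<in> B)"
    using assms by (auto simp: has_support_def zero_less_mult_iff) (metis linorder_not_less)+
  also have "\<dots> \<longleftrightarrow> n \<in> (\<lambda>(a, b). a + b) ` (A \<times> B)" by force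
  finally show "fps_nth (F * G) n > 0 \<longleftrightarrow> n \<in> (\<lambda>(a, b). a + b) ` (A \<times> B)" .
qed

lemma has_support_power: "has_support F A \<Longrightarrow> has_support (F ^ k) (nsum A k)"
proof (induction k)
  case 0
  show ?case by (auto simp: has_support_def)
next
  case (Suc k)
  from has_support_mult[OF Suc.prems Suc.IH[OF Suc.prems]] show ?case by simp
qed

text \<open>Multiplicities are kept because initial exponents can coincide: \<open>m = 1\<close> and
  \<open>m = 2\<close> both give the exponent 1 in the first sum of the theorem.\<close>

definition occurrence_fps :: "(nat \<Rightarrow> nat) \<Rightarrow> real fps" where
  "occurrence_fps f = Abs_fps (\<lambda>n. real (card {m. f m = n}))"

lemma finite_fibre:
  fixes f :: "nat \<Rightarrow> nat"
  assumes "\<And>m. m \<ge> M \<Longrightarrow> m \<le> f m"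
  shows "finite {m. f m = n}" "card {m. f m = n} \<le> M + n + 1"
proof -
  have sub: "{m. f m = n} \<subseteq> {..M + n}"
  proof
    fix m assume "m \<in> {m. f m = n}"
    thus "m \<in> {..M + n}" using assms[of m] by (cases "m \<ge> M") auto
  qed
  thus "finite {m. f m = n}" by (rule finite_subset) simp
  have "card {m. f m = n} \<le> card {..M + n}" using sub by (rule card_mono[rotated]) simp
  thus "card {m. f m = n} \<le> M + n + 1" by simp
qed

lemma occurrence_fps:
  fixes f :: "nat \<Rightarrow> nat"
  assumes f: "\<And>m. m \<ge> M \<Longrightarrow> m \<le> f m"
  shows poly_bounded_occurrence_fps: "poly_bounded (occurrence_fps f)"
    and has_support_occurrence_fps: "has_support (occurrence_fps f) (range f)"
    and sums_occurrence_fps: "0 < b \<Longrightarrow> b < 1 \<Longrightarrow> (\<lambda>m. b ^ f m) sums eval_fps (occurrence_fps f) b"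
proof -
  note fib = finite_fibre[of M f, OF f]
  show pb: "poly_bounded (occurrence_fps f)"
    unfolding poly_bounded_def
  proof (intro exI[of _ "real (M + 1)"] exI[of _ 1] conjI allI)
    fix n
    have "M + n + 1 \<le> (M + 1) * (n + 1)" by (simp add: algebra_simps)
    with fib(2)[of n] have "card {m. f m = n} \<le> (M + 1) * (n + 1)" by linarith
    hence "real (card {m. f m = n}) \<le> real (M + 1) * real (n + 1)" by (metis of_nat_le_iff of_nat_mult)
    thus "\<bar>fps_nth (occurrence_fps f) n\<bar> \<le> real (M + 1) * real (n + 1) ^ 1" by (simp add: occurrence_fps_def)
  qed simp
  show "has_support (occurrence_fps f) (range f)"
    unfolding has_support_def occurrence_fps_def using fib(1) by (auto simp: card_gt_0_iff)
  assume b: "0 < b" "b < 1"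
  have "summable (\<lambda>n. fps_nth (occurrence_fps f) n * b ^ n)"
    by (rule summable_fps) (use poly_bounded_conv_radius[OF pb b] in simp)
  hence "(\<lambda>n. fps_nth (occurrence_fps f) n * b ^ n) sums eval_fps (occurrence_fps f) b"
    unfolding eval_fps_def by (rule summable_sums)
  \<comment> \<open>Nonnegative terms permit unordered summation, in which the sum over
    \<open>m\<close> can be regrouped by the value of \<open>f\<close>.\<close>
  hence hs: "((\<lambda>n. fps_nth (occurrence_fps f) n * b ^ n) has_sum eval_fps (occurrence_fps f) b) UNIV"
    using b by (intro sums_nonneg_imp_has_sum) (auto simp: occurrence_fps_def)
  have inner: "((\<lambda>m. b ^ n) has_sum (fps_nth (occurrence_fps f) n * b ^ n)) {m. f m = n}" for n
    using has_sum_finite[OF fib(1)[of n], of "\<lambda>m. b ^ n"] by (simp add: occurrence_fps_def)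
  have "((\<lambda>(n, m). b ^ n) has_sum eval_fps (occurrence_fps f) b) (Sigma UNIV (\<lambda>n. {m. f m = n}))"
  proof (rule has_sum_SigmaI)
    show "(\<lambda>(n, m). b ^ n) summable_on Sigma UNIV (\<lambda>n. {m. f m = n})"
      by (rule summable_on_SigmaI[where g = "\<lambda>n. fps_nth (occurrence_fps f) n * b ^ n"])
         (use inner hs b in \<open>auto simp: has_sum_imp_summable\<close>)
  qed (use inner hs in auto)
  also have "Sigma UNIV (\<lambda>n. {m. f m = n}) = (\<lambda>m. (f m, m)) ` UNIV" by auto
  finally have "((\<lambda>(n, m). b ^ n) \<circ> (\<lambda>m. (f m, m)) has_sum eval_fps (occurrence_fps f) b) UNIV"
    by (subst (asm) has_sum_reindex) (auto simp: inj_on_def)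
  thus "(\<lambda>m. b ^ f m) sums eval_fps (occurrence_fps f) b"
    using has_sum_imp_sums by (force simp: o_def)
qed


section \<open>The leading monomial of an algebraic relation\<close>

lemma eval_bivariate_eq_sum:
  fixes x y :: real
  assumes "\<And>j. degree (coeff P j) \<le> K"
  shows "eval_bivariate P x y = (\<Sum>j\<le>degree P. \<Sum>i\<le>K. of_rat (coeff (coeff P j) i) * (x ^ i * y ^ j))"
proof -
  let ?h = "\<lambda>q. poly (map_poly of_rat q) x"
  have "degree (map_poly ?h P) \<le> degree P" by (rule degree_map_poly_le)
  hence "poly (map_poly ?h P) y = (\<Sum>j\<le>degree P. coeff (map_poly ?h P) j * y ^ j)"
    by (subst poly_as_sum_of_monoms' [symmetric]) (simp_all add: poly_sum poly_monom)
  also have "\<dots> = (\<Sum>j\<le>degree P. ?h (coeff P j) * y ^ j)" by (simp add: coeff_map_poly)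
  also have "\<dots> = (\<Sum>j\<le>degree P. (\<Sum>i\<le>K. of_rat (coeff (coeff P j) i) * x ^ i) * y ^ j)"
  proof (intro sum.cong refl arg_cong2[where f = "(*)"])
    fix j
    have "degree (map_poly of_rat (coeff P j) :: real poly) \<le> K" using assms[of j] by simp
    thus "?h (coeff P j) = (\<Sum>i\<le>K. of_rat (coeff (coeff P j) i) * x ^ i)"
      by (subst poly_as_sum_of_monoms' [symmetric]) (simp_all add: poly_sum poly_monom)
  qed
  finally show ?thesis by (simp add: eval_bivariate_def sum_distrib_left sum_distrib_right mult_ac)
qed

lemma fps_nth_in_Ints:
  fixes F G :: "real fps"
  shows fps_mult_in_Ints: "(\<And>n. fps_nth F n \<in> \<int>) \<Longrightarrow> (\<And>n. fps_nth G n \<in> \<int>) \<Longrightarrow> fps_nth (F * G) n \<in> \<int>"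
    and fps_power_in_Ints: "(\<And>n. fps_nth F n \<in> \<int>) \<Longrightarrow> fps_nth (F ^ k) n \<in> \<int>"
proof -
  show 1: "fps_nth (F * G) n \<in> \<int>" if "\<And>n. fps_nth F n \<in> \<int>" "\<And>n. fps_nth G n \<in> \<int>" for F G :: "real fps" and n
    unfolding fps_mult_nth using that by auto
  show "fps_nth (F ^ k) n \<in> \<int>" if "\<And>n. fps_nth F n \<in> \<int>"
    using that by (induction k arbitrary: n) (auto intro!: 1)
qed

lemma gap_series_algebraically_independent:
  fixes \<beta> :: real and F1 F2 :: "real fps"
  assumes \<beta>: "algebraic_int \<beta>" "\<beta> > 1"
    and conj: "\<And>z. is_conjugate_of z \<beta> \<Longrightarrow> z \<noteq> complex_of_real \<beta> \<Longrightarrow> cmod z \<le> 1"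
    and F: "poly_bounded F1" "poly_bounded F2" "\<And>n. fps_nth F1 n \<in> \<int>" "\<And>n. fps_nth F2 n \<in> \<int>"
      "has_support F1 g1.S" "has_support F2 g2.S"
  shows "algebraically_independent (eval_fps F1 (1 / \<beta>)) (eval_fps F2 (1 / \<beta>))"
  unfolding algebraically_independent_def
proof (intro allI impI notI)
  fix P :: "rat poly poly"
  define b where "b = 1 / \<beta>"
  have b: "0 < b" "b < 1" using \<beta> by (auto simp: b_def)
  define x where "x = eval_fps F1 b"
  define y where "y = eval_fps F2 b"
  assume "P \<noteq> 0" and "eval_bivariate P (eval_fps F1 (1 / \<beta>)) (eval_fps F2 (1 / \<beta>)) = 0"
  hence zero: "eval_bivariate P x y = 0" by (simp add: x_def y_def b_def)
  define d where "d = degree P"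
  define i0 where "i0 = degree (coeff P d)"
  \<comment> \<open>The sum is a convenient common bound for the degrees in \<open>X\<close>, so
    that all monomials lie in the rectangle \<open>i \<le> K\<close>,
    \<open>j \<le> d\<close>.\<close>
  define K where "K = (\<Sum>j\<le>d. degree (coeff P j))"
  have K: "degree (coeff P j) \<le> K" for j
  proof (cases "j \<le> d")
    case True
    thus ?thesis unfolding K_def by (intro member_le_sum) auto
  next
    case False
    hence "coeff P j = 0" unfolding d_def by (intro coeff_eq_0) auto
    thus ?thesis by simp
  qed
  obtain \<Delta> :: int where \<Delta>: "\<Delta> > 0" "\<And>i j. i \<le> K \<Longrightarrow> j \<le> d \<Longrightarrow> of_int \<Delta> * coeff (coeff P j) i \<in> \<int>"
    using finite_common_denominator[of "(\<lambda>(i, j). coeff (coeff P j) i) ` ({..K} \<times> {..d})"] by auto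
  define c where "c = (\<lambda>i j. of_rat (of_int \<Delta> * coeff (coeff P j) i) :: real)"
  have c_int: "c i j \<in> \<int>" if "i \<le> K" "j \<le> d" for i j
    using \<Delta>(2)[OF that] by (auto simp: c_def elim!: Ints_cases)
  have c0: "c i0 d \<noteq> 0" using \<open>P \<noteq> 0\<close> \<Delta>(1) by (simp add: c_def i0_def d_def)
  \<comment> \<open>The extra factor \<open>F1 * F2\<close> makes both leading exponents positive.\<close>
  define A where "A = (\<lambda>i j. F1 ^ i * F2 ^ j)"
  define \<Phi> where "\<Phi> = (\<Sum>j\<le>d. \<Sum>i\<le>K. fps_const (c i j) * A (Suc i) (Suc j))"
  have pbA: "poly_bounded (A i j)" for i j
    unfolding A_def by (intro poly_bounded_mult poly_bounded_power F)
  have pb\<Phi>: "poly_bounded \<Phi>"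
    unfolding \<Phi>_def by (intro poly_bounded_sum poly_bounded_mult poly_bounded_const pbA)
  have suppA: "has_support (A i j) (mixed_sums g1.S g2.S i j)" for i j
    unfolding A_def mixed_sums_def by (intro has_support_mult has_support_power F)
  have A_int: "fps_nth (A i j) n \<in> \<int>" for i j n
    unfolding A_def by (intro fps_mult_in_Ints fps_power_in_Ints F)
  have nth\<Phi>: "fps_nth \<Phi> n = (\<Sum>j\<le>d. \<Sum>i\<le>K. c i j * fps_nth (A (Suc i) (Suc j)) n)" for n
    by (simp add: \<Phi>_def fps_sum_nth)
  have \<Phi>_int: "fps_nth \<Phi> n \<in> \<int>" for n
    unfolding nth\<Phi> by (intro Ints_sum Ints_mult c_int A_int) auto
  define \<rho> where "\<rho> = (\<lambda>n. \<lfloor>fps_nth \<Phi> n\<rfloor>)"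
  have \<rho>: "of_int (\<rho> n) = fps_nth \<Phi> n" for n
    using \<Phi>_int[of n] by (auto simp: \<rho>_def elim!: Ints_cases)
  have evA: "eval_fps (A i j) b = x ^ i * y ^ j" for i j
  proof -
    have "eval_fps (A i j) b = eval_fps (F1 ^ i) b * eval_fps (F2 ^ j) b"
      unfolding A_def by (intro eval_fps_mult poly_bounded_conv_radius poly_bounded_power F b)
    also have "eval_fps (F1 ^ i) b = x ^ i"
      unfolding x_def by (intro eval_fps_power poly_bounded_conv_radius F b)
    also have "eval_fps (F2 ^ j) b = y ^ j"
      unfolding y_def by (intro eval_fps_power poly_bounded_conv_radius F b)
    finally show ?thesis .
  qed
  have "eval_fps \<Phi> b = (\<Sum>j\<le>d. \<Sum>i\<le>K. c i j * (x ^ Suc i * y ^ Suc j))"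
  proof -
    have "eval_fps (fps_const (c i j) * A (Suc i) (Suc j)) b = c i j * (x ^ Suc i * y ^ Suc j)" for i j
      using evA[of "Suc i" "Suc j"] poly_bounded_conv_radius[OF pbA b]
      by (subst eval_fps_mult) auto
    thus ?thesis
      unfolding \<Phi>_def using b
      by (simp add: eval_fps_sum_poly_bounded poly_bounded_sum poly_bounded_mult poly_bounded_const pbA)
  qed
  \<comment> \<open>Apart from clearing denominators, the shifted exponents contribute only the
    factor \<open>x * y\<close>, so the relation persists.\<close>
  also have "\<dots> = of_int \<Delta> * x * y * eval_bivariate P x y"
    unfolding eval_bivariate_eq_sum[OF K] d_def [symmetric]
    by (simp add: c_def of_rat_mult sum_distrib_left mult_ac)
  finally have "eval_fps \<Phi> b = 0" using zero by simp
  moreover have "summable (\<lambda>n. fps_nth \<Phi> n * b ^ n)"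
    by (rule summable_fps) (use poly_bounded_conv_radius[OF pb\<Phi> b] in simp)
  ultimately have sums0: "(\<lambda>n. of_int (\<rho> n) * (1 / \<beta>) ^ n) sums 0"
    unfolding \<rho> b_def [symmetric] eval_fps_def by (metis summable_sums)
  obtain C e where "\<And>n. \<bar>fps_nth \<Phi> n\<bar> \<le> C * real (n + 1) ^ e"
    using pb\<Phi> unfolding poly_bounded_def by blast
  hence bound: "\<bar>real_of_int (\<rho> n)\<bar> \<le> C * real (n + 1) ^ e" for n
    by (simp add: \<rho>)
  obtain B where B: "B > 0" "\<And>R G. (\<forall>n. R < n \<and> n \<le> R + G \<longrightarrow> \<rho> n = 0) \<Longrightarrow>
      B * ln (real (R + G + 2)) \<le> real G \<Longrightarrow> (\<Sum>n\<le>R. of_int (\<rho> n) * (1 / \<beta>) ^ n) = 0"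
    using cluster_sum_eq_0[OF \<beta> conj bound sums0] by blast
  let ?k = "Suc i0" and ?D = "Suc d"
  let ?Q = "mixed_sums g1.S g2.S"
  have "\<exists>u R1 R2 G. u \<in> ?Q ?k ?D \<and> R1 + G < u \<and> u \<le> R2 \<and>
    B * ln (real (R1 + G + 2)) \<le> real G \<and> B * ln (real (R2 + G + 2)) \<le> real G \<and>
    (\<forall>n i j. R1 < n \<and> n \<le> R2 + G \<longrightarrow> j < ?D \<and> i \<le> Suc K \<or> j = ?D \<and> i < ?k \<longrightarrow> n \<notin> ?Q i j) \<and>
    (\<forall>n. R1 < n \<and> n \<le> R1 + G \<or> R2 < n \<and> n \<le> R2 + G \<longrightarrow> n \<notin> ?Q ?k ?D)"
    by (rule isolated_cluster) (use B in auto)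
  then obtain u R1 R2 G where u: "u \<in> ?Q ?k ?D" "R1 + G < u" "u \<le> R2"
    "B * ln (real (R1 + G + 2)) \<le> real G" "B * ln (real (R2 + G + 2)) \<le> real G"
    and lower: "\<And>n i j. R1 < n \<Longrightarrow> n \<le> R2 + G \<Longrightarrow> j < ?D \<and> i \<le> Suc K \<or> j = ?D \<and> i < ?k \<Longrightarrow> n \<notin> ?Q i j"
    and gaps: "\<And>n. R1 < n \<and> n \<le> R1 + G \<or> R2 < n \<and> n \<le> R2 + G \<Longrightarrow> n \<notin> ?Q ?k ?D"
    by blast
  have lead: "fps_nth \<Phi> n = c i0 d * fps_nth (A ?k ?D) n" if n: "R1 < n" "n \<le> R2 + G" for n
  proof -
    \<comment> \<open>Monomials beyond the leading one, with \<open>j = d\<close> and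
      \<open>i > i0\<close>, have coefficient 0; all others are excluded from the window.\<close>
    have "c i j * fps_nth (A (Suc i) (Suc j)) n = 0" if "i \<le> K" "j \<le> d" "(i, j) \<noteq> (i0, d)" for i j
    proof (cases "j = d \<and> i0 < i")
      case True
      hence "coeff (coeff P j) i = 0" unfolding i0_def by (intro coeff_eq_0) auto
      thus ?thesis by (simp add: c_def)
    next
      case False
      hence "n \<notin> ?Q (Suc i) (Suc j)" using that by (intro lower[OF n]) auto
      thus ?thesis using has_support_nth_eq_0[OF suppA] by simp
    qed
    hence "fps_nth \<Phi> n = (\<Sum>j\<le>d. \<Sum>i\<le>K. if i = i0 \<and> j = d then c i0 d * fps_nth (A ?k ?D) n else 0)"
      unfolding nth\<Phi> by (intro sum.cong refl) auto
    also have "\<dots> = (\<Sum>j\<le>d. if j = d then c i0 d * fps_nth (A ?k ?D) n else 0)"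
      using K[of d] by (intro sum.cong refl) (auto simp: i0_def)
    finally show ?thesis by simp
  qed
  have \<rho>_gap: "\<rho> n = 0" if "R1 < n \<and> n \<le> R1 + G \<or> R2 < n \<and> n \<le> R2 + G" for n
  proof -
    have "fps_nth (A ?k ?D) n = 0" using has_support_nth_eq_0[OF suppA gaps[OF that]] .
    moreover have "R1 < n" "n \<le> R2 + G" using that u by linarith+
    ultimately show ?thesis using lead[of n] by (simp add: \<rho>_def)
  qed
  have "(\<Sum>n\<le>R1. of_int (\<rho> n) * (1 / \<beta>) ^ n) = 0" "(\<Sum>n\<le>R2. of_int (\<rho> n) * (1 / \<beta>) ^ n) = 0"
    using \<rho>_gap u by (intro B(2)[of _ G]; blast)+
  moreover have "(\<Sum>n\<le>R2. of_int (\<rho> n) * (1 / \<beta>) ^ n) =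
      (\<Sum>n\<le>R1. of_int (\<rho> n) * (1 / \<beta>) ^ n) + (\<Sum>n\<in>{R1<..R2}. of_int (\<rho> n) * (1 / \<beta>) ^ n)"
  proof -
    have "{..R2} = {..R1} \<union> {R1<..R2}" using u by auto
    moreover have "{..R1} \<inter> {R1<..R2} = {}" by auto
    ultimately show ?thesis by (simp only: sum.union_disjoint finite_atMost finite_greaterThanAtMost)
  qed
  ultimately have "0 = (\<Sum>n\<in>{R1<..R2}. of_int (\<rho> n) * b ^ n)" by (simp add: b_def)
  also have "\<dots> = c i0 d * (\<Sum>n\<in>{R1<..R2}. fps_nth (A ?k ?D) n * b ^ n)"
    unfolding \<rho> sum_distrib_left by (intro sum.cong refl) (use lead in auto)
  finally have "(\<Sum>n\<in>{R1<..R2}. fps_nth (A ?k ?D) n * b ^ n) = 0" using c0 by simp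
  moreover have "(\<Sum>n\<in>{R1<..R2}. fps_nth (A ?k ?D) n * b ^ n) > 0"
  proof (rule sum_pos2[of _ u])
    show "u \<in> {R1<..R2}" using u by auto
    show "0 < fps_nth (A ?k ?D) u * b ^ u" using suppA[of ?k ?D] u(1) b by (simp add: has_support_def)
    show "0 \<le> fps_nth (A ?k ?D) n * b ^ n" for n using suppA[of ?k ?D] b by (simp add: has_support_def)
  qed simp
  ultimately show False by simp
qed


section \<open>The two sums of the theorem\<close>

lemma powr_exponent_ge_1_imp_le_nat_floor:
  fixes a :: real
  assumes "1 \<le> a" "m \<le> n"
  shows "m \<le> nat \<lfloor>real n powr a\<rfloor>"
proof (cases "n = 0")
  case False
  hence "real n powr 1 \<le> real n powr a" using assms(1) by (intro powr_mono) auto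
  hence "real n \<le> real n powr a" by simp
  hence "n \<le> nat \<lfloor>real n powr a\<rfloor>" by linarith
  with assms(2) show ?thesis by linarith
qed (use assms in simp)

theorem corollary3p4:
  fixes \<beta> :: real
  assumes "pisot_number \<beta> \<or> salem_number \<beta>"
  shows "algebraically_independent
           (\<Sum>m. \<beta> powi (- \<lfloor>real (m + 1) powr ln (real (m + 1))\<rfloor>))
           (\<Sum>m. \<beta> powi (- \<lfloor>real (m + 3) powr ln (ln (real (m + 3)))\<rfloor>))"
proof -
  have \<beta>: "algebraic_int \<beta>" "\<beta> > 1"
    and conj: "\<And>z. is_conjugate_of z \<beta> \<Longrightarrow> z \<noteq> complex_of_real \<beta> \<Longrightarrow> cmod z \<le> 1"
    using assms unfolding pisot_number_def salem_number_def by (auto intro: less_imp_le)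
  have b: "0 < 1 / \<beta>" "1 / \<beta> < 1" using \<beta> by auto
  define f1 where "f1 = (\<lambda>m. g1.w (m + 1))"
  define f2 where "f2 = (\<lambda>m. g2.w (m + 3))"
  \<comment> \<open>From \<open>exp (exp 1)\<close> on, both \<open>ln\<close> and \<open>ln\<close>
    of \<open>ln\<close> are at least 1, so the exponents grow at least as fast as the
    index.\<close>
  define M where "M = nat \<lceil>exp (exp 1 :: real)\<rceil>"
  have M: "exp (exp 1) \<le> real m" if "m \<ge> M" for m
  proof -
    have "exp (exp 1) \<le> real M" unfolding M_def by (rule real_nat_ceiling_ge)
    thus ?thesis using that by linarith
  qed
  have f1: "m \<le> f1 m" if "m \<ge> M" for m
    unfolding f1_def g1.w_def
    by (rule powr_exponent_ge_1_imp_le_nat_floor[OF ln_ge_1])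
       (use M[of "m + 1"] that order.trans[OF exp_exp_1_ge(1)] in auto)
  have f2: "m \<le> f2 m" if "m \<ge> M" for m
    unfolding f2_def g2.w_def
    by (rule powr_exponent_ge_1_imp_le_nat_floor[OF ln_ln_ge_1]) (use M[of "m + 3"] that in auto)
  have powi: "\<beta> powi (- \<lfloor>r\<rfloor>) = (1 / \<beta>) ^ nat \<lfloor>r\<rfloor>" if "r \<ge> 0" for r :: real
    using that \<beta>(2) by (simp add: power_int_def power_one_over inverse_eq_divide)
  have shift: "range (\<lambda>m. h (m + n)) = h ` {n..}" for h :: "nat \<Rightarrow> nat" and n
  proof -
    have "x \<in> range (\<lambda>m. m + n)" if "n \<le> x" for x
      using that by (intro image_eqI[of _ _ "x - n"]) auto
    hence "range (\<lambda>m. m + n) = {n..}" by auto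
    thus ?thesis by (metis image_image)
  qed
  have S1: "range f1 = g1.S" unfolding f1_def g1.S_def by (rule shift)
  have S2: "range f2 = g2.S" unfolding f2_def g2.S_def by (rule shift)
  have "algebraically_independent (eval_fps (occurrence_fps f1) (1 / \<beta>)) (eval_fps (occurrence_fps f2) (1 / \<beta>))"
  proof (rule gap_series_algebraically_independent[OF \<beta> conj])
    show "poly_bounded (occurrence_fps f1)" "poly_bounded (occurrence_fps f2)"
      by (rule poly_bounded_occurrence_fps[of M], rule f1 f2, assumption)+
    show "has_support (occurrence_fps f1) g1.S" unfolding S1 [symmetric]
      by (rule has_support_occurrence_fps[of M], rule f1)
    show "has_support (occurrence_fps f2) g2.S" unfolding S2 [symmetric]
      by (rule has_support_occurrence_fps[of M], rule f2)
  qed (auto simp: occurrence_fps_def)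
  moreover have "(\<Sum>m. \<beta> powi (- \<lfloor>real (m + 1) powr ln (real (m + 1))\<rfloor>)) = eval_fps (occurrence_fps f1) (1 / \<beta>)"
    using sums_unique[OF sums_occurrence_fps[OF f1 b]]
    by (simp add: powi f1_def g1.w_def)
  moreover have "(\<Sum>m. \<beta> powi (- \<lfloor>real (m + 3) powr ln (ln (real (m + 3)))\<rfloor>)) = eval_fps (occurrence_fps f2) (1 / \<beta>)"
    using sums_unique[OF sums_occurrence_fps[OF f2 b]]
    by (simp add: powi f2_def g2.w_def)
  ultimately show ?thesis by simp
qed


end
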